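(* Let $X$ and $Y$ be connected topological manifolds (possibly with boundary) of equal dimensions, with $X$ compact. Let $f\colon X\to Y$ be a continuous mapping such that $f(\partial X)\subseteq \partial Y$ and such that $f|_{\partial X}$ and $f|_{X\setminus\partial X}$ are immersions. Suppose that there is no proper subgroup of finite index in the fundamental group $\pi_1(Y)$ that is isomorphic to $\pi_1(X)$. Then $f$ is a homeomorphism of $X$ onto $Y$.
   Context: An $n$-dimensional topological manifold is a Hausdorff topological space having a countable cover by open sets each of which is homeomorphic either to $\mathbb{R}^n$ or to the half-space $\mathbb{R}^n_+=\{(x_1,\ldots,x_n) : x_i\in\mathbb{R},\ x_1\ge 0\}$. Points having a neighborhood homeomorphic to $\mathbb{R}^n$ are interior points; the boundary $\partial X$ is the subspace of points that are not interior (it may be empty). A continuous mapping $g\colon A\to B$ of topological spaces is called an immersion if every point $a\in A$ has a neighborhood $U$ in $A$ such that $g|_U$ is a homeomorphism of $U$ onto $g(U)$. In particular, "$f|_{\partial X}$ is an immersion" refers to neighborhoods in $\partial X$, not in $X$. A proper subgroup is a subgroup that does not coincide with the whole group. *)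

theory Defs
  imports "HOL-Homology.Homology"
begin

section \<open>Topological manifolds with boundary\<close>

text \<open>
  The coordinates of \<^term>\<open>Euclidean_space n\<close> are numbered from \<open>0\<close>, so the constraint on
  the first coordinate reads \<open>x 0 \<ge> 0\<close>. For \<open>n = 0\<close> it is vacuous and the
  half-space is the one-point space.
\<close>

definition Euclidean_half_space :: "nat \<Rightarrow> (nat \<Rightarrow> real) topology"
  where "Euclidean_half_space n = subtopology (Euclidean_space n) {x. x 0 \<ge> 0}"

definition topological_manifold :: "nat \<Rightarrow> 'a topology \<Rightarrow> bool"
  where "topological_manifold n X \<longleftrightarrow>
    Hausdorff_space X \<and>
    (\<exists>\<U>. countable \<U> \<and> \<Union>\<U> = topspace X \<and>
         (\<forall>U\<in>\<U>. openin X U \<and>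
              (subtopology X U homeomorphic_space Euclidean_space n \<or>
               subtopology X U homeomorphic_space Euclidean_half_space n)))"

definition manifold_interior :: "nat \<Rightarrow> 'a topology \<Rightarrow> 'a set"
  where "manifold_interior n X =
    {x. \<exists>U. openin X U \<and> x \<in> U \<and> subtopology X U homeomorphic_space Euclidean_space n}"

definition manifold_boundary :: "nat \<Rightarrow> 'a topology \<Rightarrow> 'a set"
  where "manifold_boundary n X = topspace X - manifold_interior n X"

section \<open>Immersions\<close>

definition immersion_map :: "'a topology \<Rightarrow> 'b topology \<Rightarrow> ('a \<Rightarrow> 'b) \<Rightarrow> bool"
  where "immersion_map A B g \<longleftrightarrow>
    continuous_map A B g \<and>
    (\<forall>a\<in>topspace A. \<exists>U. openin A U \<and> a \<in> U \<and>
        homeomorphic_map (subtopology A U) (subtopology B (g ` U)) g)"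

section \<open>The fundamental group\<close>

definition loops_at :: "'a topology \<Rightarrow> 'a \<Rightarrow> (real \<Rightarrow> 'a) set"
  where "loops_at X a = {p. pathin X p \<and> p 0 = a \<and> p 1 = a}"

definition loop_homotopy :: "'a topology \<Rightarrow> 'a \<Rightarrow> ((real \<Rightarrow> 'a) \<times> (real \<Rightarrow> 'a)) set"
  where "loop_homotopy X a =
    {(p, q). homotopic_with (\<lambda>r. r 0 = a \<and> r 1 = a) (top_of_set {0..1}) X p q}"

text \<open>
  The library operation \<^term>\<open>joinpaths\<close> is restricted to the class
  \<^class>\<open>topological_space\<close>; this is the same operation on an arbitrary type.
\<close>

definition loop_join :: "(real \<Rightarrow> 'a) \<Rightarrow> (real \<Rightarrow> 'a) \<Rightarrow> real \<Rightarrow> 'a"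
  where "loop_join p q = (\<lambda>t. if t \<le> 1/2 then p (2 * t) else q (2 * t - 1))"

definition fundamental_group :: "'a topology \<Rightarrow> 'a \<Rightarrow> (real \<Rightarrow> 'a) set monoid"
  where "fundamental_group X a =
    \<lparr>carrier = loops_at X a // loop_homotopy X a,
     mult = (\<lambda>P Q. \<Union>p\<in>P. \<Union>q\<in>Q. loop_homotopy X a `` {loop_join p q}),
     one = loop_homotopy X a `` {\<lambda>t. a}\<rparr>"

lemma loop_homotopy_imp_loops:
  assumes "(p, q) \<in> loop_homotopy X a"
  shows "p \<in> loops_at X a" "q \<in> loops_at X a"
  using homotopic_with_imp_continuous_maps[of _ "top_of_set {0..1}" X p q]
    homotopic_with_imp_property[of _ "top_of_set {0..1}" X p q] assms
  by (auto simp: loop_homotopy_def loops_at_def pathin_def)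

lemma equiv_loop_homotopy: "equiv (loops_at X a) (loop_homotopy X a)"
proof (rule equivI)
  show "loop_homotopy X a \<subseteq> loops_at X a \<times> loops_at X a"
    using loop_homotopy_imp_loops by fastforce
  show "refl_on (loops_at X a) (loop_homotopy X a)"
    by (auto simp: refl_on_def loop_homotopy_def loops_at_def pathin_def)
  show "sym (loop_homotopy X a)"
    by (auto simp: sym_def loop_homotopy_def homotopic_with_sym)
  show "trans (loop_homotopy X a)"
    unfolding trans_def loop_homotopy_def by (auto intro: homotopic_with_trans)
qed

lemma loop_homotopy_join:
  assumes "(p, p') \<in> loop_homotopy X a" "(q, q') \<in> loop_homotopy X a"
  shows "(loop_join p q, loop_join p' q') \<in> loop_homotopy X a"
proof -
  let ?I = "top_of_set {0..1::real}"
  obtain h where h: "continuous_map (prod_topology ?I ?I) X h"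
      "\<And>x. h (0, x) = p x" "\<And>x. h (1, x) = p' x"
      "\<And>t. t \<in> {0..1} \<Longrightarrow> h (t, 0) = a \<and> h (t, 1) = a"
    using assms(1) by (auto simp: loop_homotopy_def homotopic_with_def)
  obtain k where k: "continuous_map (prod_topology ?I ?I) X k"
      "\<And>x. k (0, x) = q x" "\<And>x. k (1, x) = q' x"
      "\<And>t. t \<in> {0..1} \<Longrightarrow> k (t, 0) = a \<and> k (t, 1) = a"
    using assms(2) by (auto simp: loop_homotopy_def homotopic_with_def)
  let ?m = "\<lambda>z. if snd z \<le> 1/2 then h (fst z, 2 * snd z) else k (fst z, 2 * snd z - 1)"
  have II: "prod_topology ?I ?I = top_of_set ({0..1} \<times> {0..1})"
    by (metis prod_topology_subtopology_eu)
  have "continuous_map (prod_topology ?I ?I) X ?m"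
  proof (rule continuous_map_cases_le)
    show "continuous_map (prod_topology ?I ?I) euclideanreal snd"
      unfolding II by (auto intro!: continuous_intros)
    show "continuous_map (prod_topology ?I ?I) euclideanreal (\<lambda>z. 1/2)"
      by simp
    show "continuous_map (subtopology (prod_topology ?I ?I) {z \<in> topspace (prod_topology ?I ?I). snd z \<le> 1/2}) X
            (\<lambda>z. h (fst z, 2 * snd z))"
      by (rule continuous_map_compose[OF _ h(1), unfolded o_def])
        (auto simp: II subtopology_subtopology intro!: continuous_intros)
    show "continuous_map (subtopology (prod_topology ?I ?I) {z \<in> topspace (prod_topology ?I ?I). 1/2 \<le> snd z}) X
            (\<lambda>z. k (fst z, 2 * snd z - 1))"
      by (rule continuous_map_compose[OF _ k(1), unfolded o_def])
        (auto simp: II subtopology_subtopology intro!: continuous_intros)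
    show "h (fst z, 2 * snd z) = k (fst z, 2 * snd z - 1)"
      if "z \<in> topspace (prod_topology ?I ?I)" "snd z = 1/2" for z
    proof -
      have *: "2 * snd z = 1" and "fst z \<in> {0..1}"
        using that by auto
      then show ?thesis
        unfolding * using h(4)[of "fst z"] k(4)[of "fst z"] by simp
    qed
  qed
  then show ?thesis
    unfolding loop_homotopy_def homotopic_with_def
    using h k by (auto intro!: exI[of _ ?m] simp: loop_join_def)
qed

lemma loop_homotopy_reparametrize:
  assumes "pathin X g" "continuous_on {0..1} \<phi>" "continuous_on {0..1} \<psi>"
    and "\<phi> ` {0..1} \<subseteq> {0..1}" "\<psi> ` {0..1} \<subseteq> {0..1}"
    and "\<phi> 0 = \<psi> 0" "\<phi> 1 = \<psi> 1" "g (\<phi> 0) = a" "g (\<phi> 1) = a"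
  shows "(g \<circ> \<phi>, g \<circ> \<psi>) \<in> loop_homotopy X a"
proof -
  let ?I = "top_of_set {0..1::real}"
  let ?m = "\<lambda>z. (1 - fst z) * \<phi> (snd z) + fst z * \<psi> (snd z)"
  have II: "prod_topology ?I ?I = top_of_set ({0..1} \<times> {0..1})"
    by (metis prod_topology_subtopology_eu)
  have 1: "continuous_on ({0..1} \<times> {0..1}) ?m"
    by (intro continuous_intros continuous_on_compose2[OF assms(2)]
        continuous_on_compose2[OF assms(3)]) auto
  have 2: "?m z \<in> {0..1}" if "z \<in> {0..1} \<times> {0..1}" for z
    using that convexD[of "{0..1::real}" "\<phi> (snd z)" "\<psi> (snd z)" "1 - fst z" "fst z"] assms(4,5)
    by (auto simp: image_subset_iff)
  have "continuous_map (prod_topology ?I ?I) ?I ?m"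
    unfolding II using 1 2 by auto
  then have "continuous_map (prod_topology ?I ?I) X (g \<circ> ?m)"
    using assms(1) continuous_map_compose pathin_def by blast
  then show ?thesis
    unfolding loop_homotopy_def homotopic_with_def
    using assms(6-9) by (auto intro!: exI[of _ "g \<circ> ?m"] simp flip: distrib_right)
qed

lemma group_fundamental_group:
  assumes "a \<in> topspace X"
  shows "group (fundamental_group X a)"
proof -
  let ?R = "loop_homotopy X a" and ?L = "loops_at X a" and ?G = "fundamental_group X a"
  note eq = equiv_loop_homotopy[of X a]
  have refl: "(p, p) \<in> ?R" if "p \<in> ?L" for p
    using that eq by (auto simp: equiv_def refl_on_def)
  have const: "(\<lambda>t. a) \<in> ?L"
    using assms by (auto simp: loops_at_def pathin_def)
  have join: "loop_join p q \<in> ?L" if "p \<in> ?L" "q \<in> ?L" for p q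
    using that loop_homotopy_join loop_homotopy_imp_loops refl by meson
  have cls: "?R `` {p} = ?R `` {q}" if "(p, q) \<in> ?R" for p q
    using that eq by (metis equiv_class_eq)
  have mult: "?R `` {p} \<otimes>\<^bsub>?G\<^esub> ?R `` {q} = ?R `` {loop_join p q}" if "p \<in> ?L" "q \<in> ?L" for p q
  proof -
    have "?R `` {loop_join p' q'} = ?R `` {loop_join p q}" if "(p, p') \<in> ?R" "(q, q') \<in> ?R" for p' q'
      using that eq by (metis equiv_class_eq loop_homotopy_join)
    then have "(\<Union>p'\<in>?R `` {p}. \<Union>q'\<in>?R `` {q}. ?R `` {loop_join p' q'}) =
        (\<Union>p'\<in>?R `` {p}. \<Union>q'\<in>?R `` {q}. ?R `` {loop_join p q})"
      by (intro SUP_cong) auto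
    also have "\<dots> = ?R `` {loop_join p q}"
      using refl[OF that(1)] refl[OF that(2)] by blast
    finally show ?thesis
      by (simp add: fundamental_group_def)
  qed
  have carrier: "P \<in> carrier ?G \<longleftrightarrow> (\<exists>p\<in>?L. P = ?R `` {p})" for P
    by (auto simp: fundamental_group_def quotient_def)
  have one: "\<one>\<^bsub>?G\<^esub> = ?R `` {\<lambda>t. a}"
    by (simp add: fundamental_group_def)
  have L: "pathin X p" "p 0 = a" "p 1 = a" if "p \<in> ?L" for p
    using that by (auto simp: loops_at_def)
  show ?thesis
  proof (rule groupI)
    show "P \<otimes>\<^bsub>?G\<^esub> Q \<in> carrier ?G" if "P \<in> carrier ?G" "Q \<in> carrier ?G" for P Q
      using that mult join by (auto simp: carrier)
    show "\<one>\<^bsub>?G\<^esub> \<in> carrier ?G"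
      using const by (auto simp: carrier one)
    show "P \<otimes>\<^bsub>?G\<^esub> Q \<otimes>\<^bsub>?G\<^esub> S = P \<otimes>\<^bsub>?G\<^esub> (Q \<otimes>\<^bsub>?G\<^esub> S)"
      if PQS: "P \<in> carrier ?G" "Q \<in> carrier ?G" "S \<in> carrier ?G" for P Q S
    proof -
      obtain p q s where pqs: "p \<in> ?L" "q \<in> ?L" "s \<in> ?L"
        and "P = ?R `` {p}" "Q = ?R `` {q}" "S = ?R `` {s}"
        using PQS by (auto simp: carrier)
      let ?g = "loop_join (loop_join p q) s"
      let ?\<phi> = "\<lambda>x::real. max (x/2) (max (x - 1/4) (2 * x - 1))"
      have "loop_join p (loop_join q s) x = (?g \<circ> ?\<phi>) x" for x
      proof -
        consider "x \<le> 1/2" | "1/2 < x" "x \<le> 3/4" | "3/4 < x"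
          by linarith
        then show ?thesis
        proof cases
          case 1
          then have "?\<phi> x = x/2" by simp
          with 1 show ?thesis by (simp add: loop_join_def)
        next
          case 2
          then have "?\<phi> x = x - 1/4" by simp
          with 2 show ?thesis by (simp add: loop_join_def algebra_simps)
        next
          case 3
          then have "?\<phi> x = 2 * x - 1" by simp
          with 3 show ?thesis by (simp add: loop_join_def)
        qed
      qed
      then have "loop_join p (loop_join q s) = ?g \<circ> ?\<phi>"
        by blast
      moreover have "(?g \<circ> id, ?g \<circ> ?\<phi>) \<in> ?R"
        by (rule loop_homotopy_reparametrize)
          (auto simp: L join pqs le_max_iff_disj intro!: continuous_intros)
      ultimately have "?R `` {?g} = ?R `` {loop_join p (loop_join q s)}"
        by (intro cls) simp
      then show ?thesis
        using pqs \<open>P = _\<close> \<open>Q = _\<close> \<open>S = _\<close> by (simp add: mult join)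
    qed
    show "\<one>\<^bsub>?G\<^esub> \<otimes>\<^bsub>?G\<^esub> P = P" if P: "P \<in> carrier ?G" for P
    proof -
      obtain p where p: "p \<in> ?L" "P = ?R `` {p}"
        using P by (auto simp: carrier)
      have "loop_join (\<lambda>t. a) p = p \<circ> (\<lambda>x. max 0 (2 * x - 1))"
      proof
        have *: "max 0 (2 * x - 1) = (if x \<le> 1/2 then 0 else 2 * x - 1)" for x :: real
          by auto
        show "loop_join (\<lambda>t. a) p x = (p \<circ> (\<lambda>x. max 0 (2 * x - 1))) x" for x
          unfolding o_def * by (simp add: loop_join_def L p)
      qed
      moreover have "(p \<circ> (\<lambda>x. max 0 (2 * x - 1)), p \<circ> id) \<in> ?R"
        by (rule loop_homotopy_reparametrize)
          (auto simp: L p intro!: continuous_intros)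
      ultimately have "?R `` {loop_join (\<lambda>t. a) p} = ?R `` {p}"
        by (intro cls) simp
      then show ?thesis
        using p const by (simp add: one mult)
    qed
    show "\<exists>Q\<in>carrier ?G. Q \<otimes>\<^bsub>?G\<^esub> P = \<one>\<^bsub>?G\<^esub>" if P: "P \<in> carrier ?G" for P
    proof -
      obtain p where p: "p \<in> ?L" "P = ?R `` {p}"
        using P by (auto simp: carrier)
      let ?r = "p \<circ> (\<lambda>x. 1 - x)"
      have "(?r, ?r) \<in> ?R"
        by (rule loop_homotopy_reparametrize)
          (auto simp: L p intro!: continuous_intros)
      then have r: "?r \<in> ?L"
        by (rule loop_homotopy_imp_loops)
      have "loop_join ?r p = p \<circ> (\<lambda>x. \<bar>1 - 2 * x\<bar>)"
        by (auto simp: loop_join_def fun_eq_iff abs_if)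
      moreover have "(p \<circ> (\<lambda>x. \<bar>1 - 2 * x\<bar>), p \<circ> (\<lambda>x. 1)) \<in> ?R"
        by (rule loop_homotopy_reparametrize)
          (auto simp: L p intro!: continuous_intros)
      moreover have "p \<circ> (\<lambda>x::real. 1) = (\<lambda>x. a)"
        by (simp add: fun_eq_iff L p)
      ultimately have "?R `` {loop_join ?r p} = ?R `` {\<lambda>t. a}"
        by (intro cls) metis
      then have "?R `` {?r} \<otimes>\<^bsub>?G\<^esub> P = \<one>\<^bsub>?G\<^esub>"
        using p r by (simp add: one mult)
      then show ?thesis
        using r carrier by blast
    qed
  qed
qed

end

theory Submission
  imports Defs "HOL-Analysis.Abstract_Topological_Spaces"
begin

text \<open>
  The map \<open>f\<close> turns out to be a covering with finitely many sheets. Its image on fundamental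
  groups is then a subgroup of finite index isomorphic to \<open>\<pi>\<^sub>1(X)\<close>, so by hypothesis it is all of
  \<open>\<pi>\<^sub>1(Y)\<close>; hence the covering has one sheet and \<open>f\<close> is a homeomorphism.

  Why \<open>f\<close> is a covering. Since \<open>X\<close> is compact and \<open>Y\<close> is Hausdorff, \<open>f\<close> is proper, and a proper
  local homeomorphism is a finite covering; so the point is that \<open>f\<close> is open and locally injective.
  At interior points this is invariance of domain, which also shows that \<open>f\<close> maps interior points
  to interior points, so that \<open>f\<close> separates the interior from the boundary
  (\<open>manifold_invariance_of_domain\<close>).
  At a boundary point \<open>x\<close> the hypothesis speaks only about the restrictions of \<open>f\<close> to the boundary
  and to the interior, and the two have to be fitted together. The fibre through \<open>x\<close> lies in the
  boundary, so \<open>x\<close> is isolated in it. Take a small half-ball \<open>V\<close> around \<open>f x\<close>; its part in the interior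
  of \<open>Y\<close> is simply connected, and over this part \<open>f\<close> is a finite covering.
  Hence \<open>f\<close> is injective on every path-connected set of interior points lying over \<open>V\<close>, in particular
  on the interior part of a small half-ball around \<open>x\<close> (\<open>locally_injective\<close>). Moreover the points over
  \<open>V\<close> that are near \<open>x\<close> have an image that meets the interior part of \<open>V\<close> in a nonempty open and closed
  set and is closed in \<open>V\<close>, so that it is all of \<open>V\<close> (\<open>boundary_neighbourhood\<close>); this is openness
  at \<open>x\<close>.

  Covering theory enters through the lifting of squares (\<open>square_lifting\<close>), which gives the lifting of
  paths and of homotopies. From these follow the injectivity of \<open>\<pi>\<^sub>1\<close> and the finiteness of the index
  (\<open>covering_fundamental_group\<close>), because a coset of the image is determined by the end point of a lift
  and that end point lies in a finite fibre; and a covering with full image on \<open>\<pi>\<^sub>1\<close> is injective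
  (\<open>covering_injective\<close>). The base points \<open>x0\<close> and \<open>y0\<close> of the statement are unrelated, so
  \<open>\<pi>\<^sub>1(X)\<close> has to be moved to a point over \<open>y0\<close> (\<open>fundamental_group_basepoint_iso\<close>).
\<close>

section \<open>Proper local homeomorphisms\<close>

text \<open>
  These are the coverings with finite fibres used below, in a form that passes to preimages of
  open sets. Fibres may be empty.
\<close>

definition proper_local_homeomorphism :: "'a topology \<Rightarrow> 'b topology \<Rightarrow> ('a \<Rightarrow> 'b) \<Rightarrow> bool"
  where "proper_local_homeomorphism E B p \<longleftrightarrow>
    Hausdorff_space E \<and> continuous_map E B p \<and> open_map E B p \<and> proper_map E B p \<and>
    (\<forall>e\<in>topspace E. \<exists>U. openin E U \<and> e \<in> U \<and> inj_on p U)"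

lemma proper_local_homeomorphismD:
  assumes "proper_local_homeomorphism E B p"
  shows "Hausdorff_space E" "continuous_map E B p" "open_map E B p" "proper_map E B p" "closed_map E B p"
    "\<And>e. e \<in> topspace E \<Longrightarrow> \<exists>U. openin E U \<and> e \<in> U \<and> inj_on p U"
    "\<And>e. e \<in> topspace E \<Longrightarrow> p e \<in> topspace B"
  using assms by (auto simp: proper_local_homeomorphism_def proper_map_def continuous_map_def)

text \<open>
  A fibre is compact, and local injectivity makes it discrete.
\<close>

lemma finite_fibre:
  assumes p: "proper_local_homeomorphism E B p" and b: "b \<in> topspace B"
  shows "finite {e \<in> topspace E. p e = b}" (is "finite ?F")
proof -
  let ?\<U> = "{U. openin E U \<and> inj_on p U}"
  have "compactin E ?F"
    using proper_local_homeomorphismD(4)[OF p] b by (simp add: proper_map_def)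
  moreover have "?F \<subseteq> \<Union>?\<U>"
    using proper_local_homeomorphismD(6)[OF p] by fastforce
  ultimately obtain \<F> where \<F>: "finite \<F>" "\<F> \<subseteq> ?\<U>" "?F \<subseteq> \<Union>\<F>"
    unfolding compactin_def by (metis (no_types, lifting) mem_Collect_eq)
  have "finite (U \<inter> ?F)" if "U \<in> \<F>" for U
  proof (rule inj_on_finite[of p _ "{b}"])
    show "inj_on p (U \<inter> ?F)"
      using that \<F>(2) by (auto intro: inj_on_subset)
  qed auto
  then have "finite (\<Union>U\<in>\<F>. U \<inter> ?F)"
    using \<F>(1) by blast
  moreover have "?F \<subseteq> (\<Union>U\<in>\<F>. U \<inter> ?F)"
    using \<F>(3) by auto
  ultimately show ?thesis
    using finite_subset by blast
qed

text \<open>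
  The local inverses of an open map are continuous.
\<close>

lemma continuous_map_inv_into:
  assumes op: "open_map E B p" and U: "openin E U" and inj: "inj_on p U"
  shows "continuous_map (subtopology B (p ` U)) E (inv_into U p)"
  unfolding continuous_map_def
proof (intro conjI allI impI)
  show "inv_into U p \<in> topspace (subtopology B (p ` U)) \<rightarrow> topspace E"
    using openin_subset[OF U] inj by (auto simp: inv_into_f_f)
  fix W assume W: "openin E W"
  have "p ` U \<subseteq> topspace B"
    using op U by (meson open_map_def openin_subset)
  then have "{y \<in> topspace (subtopology B (p ` U)). inv_into U p y \<in> W} = p ` (U \<inter> W)"
    using inj by (auto simp: inv_into_f_f)
  moreover have "openin B (p ` (U \<inter> W))"
    using op U W by (meson open_map_def openin_Int)
  ultimately show "openin (subtopology B (p ` U)) {y \<in> topspace (subtopology B (p ` U)). inv_into U p y \<in> W}"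
    unfolding openin_subtopology by (intro exI[of _ "p ` (U \<inter> W)"]) auto
qed

text \<open>
  This plays the role of evenly covered neighbourhoods. The open set is what is left of the
  intersection of the finitely many sets \<open>p ` U e\<close>, where \<open>U e\<close> is a neighbourhood of the point \<open>e\<close> of
  the fibre on which \<open>p\<close> is injective, after removing the image of all points outside these
  neighbourhoods; that image is closed because \<open>p\<close> is a closed map.
\<close>

lemma local_sections:
  assumes p: "proper_local_homeomorphism E B p" and b: "b \<in> topspace B"
  obtains V where "openin B V" "b \<in> V"
    "\<And>e. \<lbrakk>e \<in> topspace E; p e \<in> V\<rbrakk> \<Longrightarrow>
       \<exists>s. continuous_map (subtopology B V) E s \<and> s (p e) = e \<and> (\<forall>v\<in>V. p (s v) = v)"
proof -
  note D = proper_local_homeomorphismD[OF p]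
  define F where "F = {e \<in> topspace E. p e = b}"
  have F: "finite F"
    unfolding F_def by (rule finite_fibre[OF p b])
  define U where "U = (\<lambda>e. SOME U. openin E U \<and> e \<in> U \<and> inj_on p U)"
  have U: "openin E (U e)" "e \<in> U e" "inj_on p (U e)" if "e \<in> F" for e
    using someI_ex[OF D(6)] that by (simp_all add: U_def F_def)
  define C where "C = topspace E - (\<Union>e\<in>F. U e)"
  define V where "V = (\<Inter>e\<in>F. p ` U e) \<inter> topspace B - p ` C"
  show ?thesis
  proof
    have "openin E (\<Union>e\<in>F. U e)"
      using U(1) by (intro openin_Union) auto
    then have "closedin B (p ` C)"
      using D(5) by (simp add: closed_map_def openin_closedin_eq C_def)
    moreover have "openin B ((\<Inter>e\<in>F. p ` U e) \<inter> topspace B)"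
      using F D(3) U(1) by (intro openin_INT) (auto simp: open_map_def)
    ultimately show "openin B V"
      unfolding V_def by (rule openin_diff[rotated])
    have "b \<notin> p ` C"
      using U(2) by (auto simp: C_def F_def)
    moreover have "b \<in> p ` U e" if "e \<in> F" for e
      using U(2)[OF that] that by (force simp: F_def)
    ultimately show "b \<in> V"
      using b by (simp add: V_def)
    show "\<exists>s. continuous_map (subtopology B V) E s \<and> s (p e) = e \<and> (\<forall>v\<in>V. p (s v) = v)"
      if e: "e \<in> topspace E" "p e \<in> V" for e
    proof -
      have "e \<notin> C"
        using e by (auto simp: V_def)
      then obtain d where d: "d \<in> F" "e \<in> U d"
        using e(1) by (auto simp: C_def)
      have VU: "V \<subseteq> p ` U d"
        using d(1) by (auto simp: V_def)
      have "continuous_map (subtopology B V) E (inv_into (U d) p)"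
        using continuous_map_inv_into[OF D(3) U(1,3)[OF d(1)]] VU
        by (rule continuous_map_from_subtopology_mono)
      moreover have "inv_into (U d) p (p e) = e"
        using U(3)[OF d(1)] d(2) by simp
      moreover have "\<forall>v\<in>V. p (inv_into (U d) p v) = v"
        using VU by (auto intro!: f_inv_into_f)
      ultimately show ?thesis
        by (intro exI conjI)
    qed
  qed
qed

text \<open>
  The set on which two lifts agree is closed because the total space is Hausdorff, and open
  because \<open>p\<close> is locally injective.
\<close>

lemma lift_unique:
  assumes p: "proper_local_homeomorphism E B p" and Z: "connected_space Z"
    and g: "continuous_map Z E g" and h: "continuous_map Z E h"
    and eq: "\<And>z. z \<in> topspace Z \<Longrightarrow> p (g z) = p (h z)"
    and z0: "z0 \<in> topspace Z" "g z0 = h z0" and z: "z \<in> topspace Z"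
  shows "g z = h z"
proof -
  note D = proper_local_homeomorphismD[OF p]
  let ?A = "{z \<in> topspace Z. g z = h z}"
  have "closedin Z ?A"
    by (rule closedin_continuous_maps_eq[OF D(1) g h])
  moreover have "openin Z ?A"
  proof (subst openin_subopen, intro ballI)
    fix w assume w: "w \<in> ?A"
    then have "g w \<in> topspace E"
      using continuous_map_image_subset_topspace[OF g] by blast
    then obtain U where U: "openin E U" "g w \<in> U" "inj_on p U"
      using D(6) by blast
    let ?T = "{z \<in> topspace Z. g z \<in> U} \<inter> {z \<in> topspace Z. h z \<in> U}"
    have "openin Z ?T"
      using g h U by (intro openin_Int openin_continuous_map_preimage)
    moreover have "w \<in> ?T" "?T \<subseteq> ?A"
      using w U eq by (auto dest: inj_onD)
    ultimately show "\<exists>T. openin Z T \<and> w \<in> T \<and> T \<subseteq> ?A"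
      by blast
  qed
  ultimately have "?A = {} \<or> ?A = topspace Z"
    using Z unfolding connected_space_clopen_in by blast
  then have "?A = topspace Z"
    using z0 by blast
  then show ?thesis
    using z by blast
qed

section \<open>Lifting paths and homotopies\<close>

text \<open>
  The lift may be prescribed at any point of \<open>S\<close>, not just at a corner: this is what allows lifts
  on two adjacent sets to be matched at a common point.
\<close>

definition liftable :: "'a topology \<Rightarrow> ('a \<Rightarrow> 'b) \<Rightarrow> ('c::topological_space \<Rightarrow> 'b) \<Rightarrow> 'c set \<Rightarrow> bool"
  where "liftable E p h S \<longleftrightarrow>
    (\<forall>z\<in>S. \<forall>e\<in>topspace E. p e = h z \<longrightarrow>
      (\<exists>k. continuous_map (top_of_set S) E k \<and> k z = e \<and> (\<forall>w\<in>S. p (k w) = h w)))"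

text \<open>
  A lift on \<open>S\<close> is extended to \<open>T\<close> by the lift that agrees with it at one common point; by
  uniqueness the two then agree on the whole connected intersection.
\<close>

lemma liftable_union_aux:
  assumes p: "proper_local_homeomorphism E B p"
    and S: "closed S" "liftable E p h S" and T: "closed T" "liftable E p h T"
    and ST: "connected (S \<inter> T)" "S \<inter> T \<noteq> {}"
    and z: "z \<in> S" and e: "e \<in> topspace E" "p e = h z"
  shows "\<exists>k. continuous_map (top_of_set (S \<union> T)) E k \<and> k z = e \<and> (\<forall>w\<in>S \<union> T. p (k w) = h w)"
proof -
  obtain k where k: "continuous_map (top_of_set S) E k" "k z = e" "\<And>w. w \<in> S \<Longrightarrow> p (k w) = h w"
    using S(2) z e unfolding liftable_def by metis
  obtain w where w: "w \<in> S" "w \<in> T"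
    using ST by blast
  have "k w \<in> topspace E"
    using k(1) w by (auto simp: continuous_map_def)
  then obtain l where l: "continuous_map (top_of_set T) E l" "l w = k w" "\<And>w. w \<in> T \<Longrightarrow> p (l w) = h w"
    using T(2) w k unfolding liftable_def by metis
  have kl: "k v = l v" if "v \<in> S \<inter> T" for v
  proof (rule lift_unique[OF p, of "top_of_set (S \<inter> T)" k l w])
    show "continuous_map (top_of_set (S \<inter> T)) E k" "continuous_map (top_of_set (S \<inter> T)) E l"
      using k(1) l(1) continuous_map_from_subtopology_mono
      by (metis Int_lower1, metis Int_lower2)
    show "connected_space (top_of_set (S \<inter> T))"
      using ST(1) by (metis connectedin_def connectedin_iff_connected)
  qed (use that w k l in auto)
  let ?m = "\<lambda>x. if x \<in> S then k x else l x"
  have "continuous_map (top_of_set (S \<union> T)) E ?m"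
    unfolding continuous_map_closedin
  proof (intro conjI allI impI)
    show "?m \<in> topspace (top_of_set (S \<union> T)) \<rightarrow> topspace E"
      using k(1) l(1) by (auto simp: continuous_map_def Pi_iff)
    fix C assume C: "closedin E C"
    have "closedin (top_of_set S) {x \<in> topspace (top_of_set S). k x \<in> C}"
      "closedin (top_of_set T) {x \<in> topspace (top_of_set T). l x \<in> C}"
      using closedin_continuous_map_preimage[OF k(1) C] closedin_continuous_map_preimage[OF l(1) C] .
    then have "closed {x \<in> topspace (top_of_set S). k x \<in> C}" "closed {x \<in> topspace (top_of_set T). l x \<in> C}"
      using S(1) T(1) closedin_closed_trans by blast+
    moreover have "{x \<in> topspace (top_of_set (S \<union> T)). ?m x \<in> C} =
      {x \<in> topspace (top_of_set S). k x \<in> C} \<union> {x \<in> topspace (top_of_set T). l x \<in> C}"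
      using kl by auto
    ultimately show "closedin (top_of_set (S \<union> T)) {x \<in> topspace (top_of_set (S \<union> T)). ?m x \<in> C}"
      by (auto intro!: closed_subset)
  qed
  then show ?thesis
    using k l z by (intro exI[of _ ?m]) auto
qed

lemma liftable_union:
  assumes p: "proper_local_homeomorphism E B p"
    and S: "closed S" "liftable E p h S" and T: "closed T" "liftable E p h T"
    and ST: "connected (S \<inter> T)" "S \<inter> T \<noteq> {}"
  shows "liftable E p h (S \<union> T)"
  unfolding liftable_def
  using liftable_union_aux[OF p S T ST] liftable_union_aux[OF p T S] ST
  by (metis Un_iff inf_commute sup_commute)

text \<open>
  A set that the map sends into the domain of the local sections is lifted by composing with a
  section.
\<close>

lemma liftable_locally:
  fixes h :: "'c::metric_space \<Rightarrow> 'b"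
  assumes p: "proper_local_homeomorphism E B p" and h: "continuous_map (top_of_set Q) B h" and z: "z \<in> Q"
  obtains r where "r > 0" "\<And>R. R \<subseteq> Q \<inter> ball z r \<Longrightarrow> liftable E p h R"
proof -
  have "h z \<in> topspace B"
    using h z by (auto simp: continuous_map_def)
  then obtain V where V: "openin B V" "h z \<in> V"
    and s: "\<And>e. \<lbrakk>e \<in> topspace E; p e \<in> V\<rbrakk> \<Longrightarrow>
       \<exists>s. continuous_map (subtopology B V) E s \<and> s (p e) = e \<and> (\<forall>v\<in>V. p (s v) = v)"
    using local_sections[OF p] by metis
  have "openin (top_of_set Q) {x \<in> topspace (top_of_set Q). h x \<in> V}"
    using h V by (intro openin_continuous_map_preimage)
  then obtain r where r: "r > 0" "Q \<inter> ball z r \<subseteq> {x \<in> Q. h x \<in> V}"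
    using z V(2) by (auto simp: openin_contains_ball Int_commute)
  show ?thesis
  proof
    fix R assume R: "R \<subseteq> Q \<inter> ball z r"
    show "liftable E p h R"
      unfolding liftable_def
    proof (intro ballI impI)
      fix x e assume x: "x \<in> R" "e \<in> topspace E" "p e = h x"
      have hV: "h ` R \<subseteq> V"
        using R r by blast
      obtain s where s: "continuous_map (subtopology B V) E s" "s (p e) = e" "\<forall>v\<in>V. p (s v) = v"
        using s[of e] x hV by auto
      have "continuous_map (top_of_set R) B h"
        using h R by (meson continuous_map_from_subtopology_mono le_inf_iff)
      then have "continuous_map (top_of_set R) E (s \<circ> h)"
        using hV s by (intro continuous_map_compose[of _ "subtopology B V"])
          (auto simp: continuous_map_in_subtopology)
      then show "\<exists>k. continuous_map (top_of_set R) E k \<and> k x = e \<and> (\<forall>w\<in>R. p (k w) = h w)"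
        using s x hV by (intro exI[of _ "s \<circ> h"]) auto
    qed
  qed (rule r)
qed

text \<open>
  Rectangles can be glued along a common edge, and small rectangles are liftable. Bisection, used in
  one coordinate and then in the other, extends this to the unit square.
\<close>

lemma square_lifting:
  fixes h :: "real \<times> real \<Rightarrow> 'b"
  assumes p: "proper_local_homeomorphism E B p"
    and h: "continuous_map (top_of_set ({0..1} \<times> {0..1})) B h"
    and e: "e \<in> topspace E" "p e = h (0, 0)"
  obtains k where "continuous_map (top_of_set ({0..1} \<times> {0..1})) E k" "k (0, 0) = e"
    "\<And>z. z \<in> {0..1} \<times> {0..1} \<Longrightarrow> p (k z) = h z"
proof -
  let ?Q = "{0..1} \<times> {0..1::real} :: (real \<times> real) set"
  have horizontal: "liftable E p h ({a..b} \<times> {c..e})"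
    if "liftable E p h ({a..b} \<times> {c..d})" "liftable E p h ({a..b} \<times> {d..e})"
      "c \<le> d" "d \<le> e" "a \<le> b" for a b c d e
  proof -
    have "({a..b} \<times> {c..d}) \<union> ({a..b} \<times> {d..e}) = {a..b} \<times> {c..e}"
      "({a..b} \<times> {c..d}) \<inter> ({a..b} \<times> {d..e}) = {a..b} \<times> {d}"
      using that by auto
    then show ?thesis
      using liftable_union[OF p _ that(1) _ that(2)] that(5)
      by (simp add: closed_Times connected_Times)
  qed
  have vertical: "liftable E p h ({a..c} \<times> {d..e})"
    if "liftable E p h ({a..b} \<times> {d..e})" "liftable E p h ({b..c} \<times> {d..e})"
      "a \<le> b" "b \<le> c" "d \<le> e" for a b c d e
  proof -
    have "({a..b} \<times> {d..e}) \<union> ({b..c} \<times> {d..e}) = {a..c} \<times> {d..e}"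
      "({a..b} \<times> {d..e}) \<inter> ({b..c} \<times> {d..e}) = {b} \<times> {d..e}"
      using that by auto
    then show ?thesis
      using liftable_union[OF p _ that(1) _ that(2)] that(5)
      by (simp add: closed_Times connected_Times)
  qed
  \<comment> \<open>Thin strips around the line with first coordinate \<open>x\<close> are liftable, by bisection in the second coordinate.\<close>
  have strip: "\<exists>\<delta>>0. \<forall>a b. a \<le> x \<and> x \<le> b \<and> b - a < \<delta> \<and> 0 \<le> a \<and> b \<le> 1 \<longrightarrow> liftable E p h ({a..b} \<times> {0..1})"
    if x: "0 \<le> x" "x \<le> 1" for x
  proof -
    have "0 \<le> (0::real) \<longrightarrow> 1 \<le> (1::real) \<longrightarrow> (\<exists>\<delta>>0. \<forall>a b. a \<le> x \<and> x \<le> b \<and> b - a < \<delta> \<and> 0 \<le> a \<and> b \<le> 1 \<longrightarrow> liftable E p h ({a..b} \<times> {0..1}))"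
    proof (rule Bolzano[where P = "\<lambda>c d. 0 \<le> c \<longrightarrow> d \<le> 1 \<longrightarrow> (\<exists>\<delta>>0. \<forall>a b. a \<le> x \<and> x \<le> b \<and> b - a < \<delta> \<and> 0 \<le> a \<and> b \<le> 1 \<longrightarrow>
            liftable E p h ({a..b} \<times> {c..d}))"])
      fix c d e :: real
      assume A1: "0 \<le> c \<longrightarrow> d \<le> 1 \<longrightarrow> (\<exists>\<delta>>0. \<forall>a b. a \<le> x \<and> x \<le> b \<and> b - a < \<delta> \<and> 0 \<le> a \<and> b \<le> 1 \<longrightarrow> liftable E p h ({a..b} \<times> {c..d}))"
        and A2: "0 \<le> d \<longrightarrow> e \<le> 1 \<longrightarrow> (\<exists>\<delta>>0. \<forall>a b. a \<le> x \<and> x \<le> b \<and> b - a < \<delta> \<and> 0 \<le> a \<and> b \<le> 1 \<longrightarrow> liftable E p h ({a..b} \<times> {d..e}))"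
        and cde: "c \<le> d" "d \<le> e"
      show "0 \<le> c \<longrightarrow> e \<le> 1 \<longrightarrow> (\<exists>\<delta>>0. \<forall>a b. a \<le> x \<and> x \<le> b \<and> b - a < \<delta> \<and> 0 \<le> a \<and> b \<le> 1 \<longrightarrow> liftable E p h ({a..b} \<times> {c..e}))"
      proof (intro impI)
        assume "0 \<le> c" "e \<le> 1"
        then have "d \<le> 1" "0 \<le> d"
          using cde by simp_all
        obtain \<delta>1 where \<delta>1: "\<delta>1 > 0"
          "\<forall>a b. a \<le> x \<and> x \<le> b \<and> b - a < \<delta>1 \<and> 0 \<le> a \<and> b \<le> 1 \<longrightarrow> liftable E p h ({a..b} \<times> {c..d})"
          using A1[rule_format, OF \<open>0 \<le> c\<close> \<open>d \<le> 1\<close>] by auto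
        obtain \<delta>2 where \<delta>2: "\<delta>2 > 0"
          "\<forall>a b. a \<le> x \<and> x \<le> b \<and> b - a < \<delta>2 \<and> 0 \<le> a \<and> b \<le> 1 \<longrightarrow> liftable E p h ({a..b} \<times> {d..e})"
          using A2[rule_format, OF \<open>0 \<le> d\<close> \<open>e \<le> 1\<close>] by auto
        from \<delta>1 \<delta>2 show "\<exists>\<delta>>0. \<forall>a b. a \<le> x \<and> x \<le> b \<and> b - a < \<delta> \<and> 0 \<le> a \<and> b \<le> 1 \<longrightarrow> liftable E p h ({a..b} \<times> {c..e})"
          using cde by (intro exI[of _ "min \<delta>1 \<delta>2"]) (auto intro!: horizontal[of _ _ c d e])
      qed
    next
      fix y :: real assume y: "0 \<le> y" "y \<le> 1"
      obtain r where r: "r > 0" "\<And>R. R \<subseteq> ?Q \<inter> ball (x, y) r \<Longrightarrow> liftable E p h R"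
        using liftable_locally[OF p h, of "(x, y)"] x y by auto
      have near: "{a..b} \<times> {c..d} \<subseteq> ?Q \<inter> ball (x, y) r"
        if "c \<le> y" "y \<le> d" "d - c < r/2" "0 \<le> c" "d \<le> 1"
          "a \<le> x" "x \<le> b" "b - a < r/2" "0 \<le> a" "b \<le> 1" for a b c d
      proof (intro subsetI)
        fix z assume z: "z \<in> {a..b} \<times> {c..d}"
        have "dist (x, y) z \<le> dist x (fst z) + dist y (snd z)"
          by (cases z) (simp add: dist_Pair_Pair sqrt_sum_squares_le_sum)
        also have "\<dots> < r"
          using z that by (auto simp: dist_real_def)
        finally show "z \<in> ?Q \<inter> ball (x, y) r"
          using z that by auto
      qed
      show "\<exists>d>0. \<forall>ca da. ca \<le> y \<and> y \<le> da \<and> da - ca < d \<longrightarrow>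
          0 \<le> ca \<longrightarrow> da \<le> 1 \<longrightarrow> (\<exists>\<delta>>0. \<forall>a b. a \<le> x \<and> x \<le> b \<and> b - a < \<delta> \<and> 0 \<le> a \<and> b \<le> 1 \<longrightarrow> liftable E p h ({a..b} \<times> {ca..da}))"
        using r near by (intro exI[of _ "r/2"] conjI allI impI) (auto intro!: exI[of _ "r/2"])
    qed simp
    then show ?thesis by simp
  qed
  have "0 \<le> (0::real) \<longrightarrow> 1 \<le> (1::real) \<longrightarrow> liftable E p h ({0..1} \<times> {0..1})"
  proof (rule Bolzano[where P = "\<lambda>a b. 0 \<le> a \<longrightarrow> b \<le> 1 \<longrightarrow> liftable E p h ({a..b} \<times> {0..1})"])
    show "\<exists>d>0. \<forall>a b. a \<le> x \<and> x \<le> b \<and> b - a < d \<longrightarrow> 0 \<le> a \<longrightarrow> b \<le> 1 \<longrightarrow> liftable E p h ({a..b} \<times> {0..1})"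
      if "0 \<le> x" "x \<le> 1" for x :: real
      using strip[OF that] by auto
  qed (use vertical in auto)
  then have "liftable E p h ?Q"
    by simp
  moreover have "(0, 0) \<in> ?Q"
    by simp
  ultimately show ?thesis
    using e that unfolding liftable_def by (metis (no_types, lifting))
qed

text \<open>
  A path is lifted as a square that is constant in the second coordinate.
\<close>

lemma path_lifting:
  assumes p: "proper_local_homeomorphism E B p" and g: "pathin B g" and e: "e \<in> topspace E" "p e = g 0"
  obtains k where "pathin E k" "k 0 = e" "\<And>t. t \<in> {0..1} \<Longrightarrow> p (k t) = g t"
proof -
  have "continuous_map (top_of_set ({0..1} \<times> {0..1::real})) B (g \<circ> fst)"
    using g unfolding pathin_def
    by (intro continuous_map_compose[of _ "top_of_set {0..1}"]) (auto intro!: continuous_intros)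
  then obtain k where k: "continuous_map (top_of_set ({0..1} \<times> {0..1})) E k" "k (0, 0::real) = e"
    "\<And>z. z \<in> {0..1} \<times> {0..1} \<Longrightarrow> p (k z) = (g \<circ> fst) z"
    using square_lifting[OF p, of "g \<circ> fst" e] e by auto
  show ?thesis
  proof
    show "pathin E (\<lambda>t. k (t, 0))"
      unfolding pathin_def
      by (rule continuous_map_compose[OF _ k(1), unfolded o_def]) (auto intro!: continuous_intros)
  qed (use k in auto)
qed

section \<open>Homotopy of paths with fixed end points\<close>

text \<open>
  Homotopy of loops is the special case \<open>p 0 = p 1\<close>. Paths with different end points are needed in
  order to move base points and to compare lifts, which need not be closed.
\<close>

definition path_homotopic :: "'a topology \<Rightarrow> (real \<Rightarrow> 'a) \<Rightarrow> (real \<Rightarrow> 'a) \<Rightarrow> bool"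
  where "path_homotopic X p q \<longleftrightarrow>
    homotopic_with (\<lambda>r. r 0 = p 0 \<and> r 1 = p 1) (top_of_set {0..1}) X p q"

definition path_rev :: "(real \<Rightarrow> 'a) \<Rightarrow> real \<Rightarrow> 'a"
  where "path_rev p = (\<lambda>t. p (1 - t))"

lemma square_topology:
  "prod_topology (top_of_set {0..1::real}) (top_of_set {0..1::real}) = top_of_set ({0..1} \<times> {0..1})"
  by (metis prod_topology_subtopology_eu)

lemma path_homotopic_iff:
  "path_homotopic X p q \<longleftrightarrow>
    (\<exists>h. continuous_map (top_of_set ({0..1::real} \<times> {0..1::real})) X h \<and>
         (\<forall>x\<in>{0..1}. h (0, x) = p x \<and> h (1, x) = q x) \<and>
         (\<forall>t\<in>{0..1}. h (t, 0) = p 0 \<and> h (t, 1) = p 1))"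
  unfolding path_homotopic_def
  by (subst homotopic_with) (simp_all add: square_topology ball_conj_distrib conj_assoc)

lemma path_homotopicI:
  assumes "continuous_map (top_of_set ({0..1::real} \<times> {0..1::real})) X h"
    and "\<And>x. x \<in> {0..1} \<Longrightarrow> h (0, x) = p x" "\<And>x. x \<in> {0..1} \<Longrightarrow> h (1, x) = q x"
    and "\<And>t. t \<in> {0..1} \<Longrightarrow> h (t, 0) = p 0" "\<And>t. t \<in> {0..1} \<Longrightarrow> h (t, 1) = p 1"
  shows "path_homotopic X p q"
  unfolding path_homotopic_iff using assms by blast

lemma path_homotopicE:
  assumes "path_homotopic X p q"
  obtains h where "continuous_map (top_of_set ({0..1::real} \<times> {0..1::real})) X h"
    and "\<And>x. x \<in> {0..1} \<Longrightarrow> h (0, x) = p x" "\<And>x. x \<in> {0..1} \<Longrightarrow> h (1, x) = q x"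
    and "\<And>t. t \<in> {0..1} \<Longrightarrow> h (t, 0) = p 0" "\<And>t. t \<in> {0..1} \<Longrightarrow> h (t, 1) = p 1"
  using assms unfolding path_homotopic_iff by blast

lemma path_homotopic_imp_pathin:
  assumes "path_homotopic X p q"
  shows "pathin X p" "pathin X q"
  using homotopic_with_imp_continuous_maps assms unfolding path_homotopic_def pathin_def by blast+

lemma path_homotopic_ends:
  assumes "path_homotopic X p q"
  shows "q 0 = p 0" "q 1 = p 1"
  using homotopic_with_imp_property assms unfolding path_homotopic_def by blast+

lemma path_homotopic_eq:
  assumes "pathin X p" "\<And>t. t \<in> {0..1} \<Longrightarrow> p t = q t"
  shows "path_homotopic X p q"
  unfolding path_homotopic_def
  using assms by (intro homotopic_with_equal) (auto simp: pathin_def)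

lemma path_homotopic_refl: "pathin X p \<Longrightarrow> path_homotopic X p p"
  by (simp add: path_homotopic_eq)

lemma path_homotopic_sym: "path_homotopic X p q \<Longrightarrow> path_homotopic X q p"
  using path_homotopic_ends[of X p q] unfolding path_homotopic_def
  by (simp add: homotopic_with_sym)

lemma path_homotopic_trans [trans]:
  "path_homotopic X p q \<Longrightarrow> path_homotopic X q r \<Longrightarrow> path_homotopic X p r"
  using path_homotopic_ends[of X p q] unfolding path_homotopic_def
  by (auto intro: homotopic_with_trans)

lemma path_homotopic_compose:
  assumes "path_homotopic X p q" "continuous_map X Y f"
  shows "path_homotopic Y (f \<circ> p) (f \<circ> q)"
proof -
  obtain h where h: "continuous_map (top_of_set ({0..1::real} \<times> {0..1::real})) X h"
    "\<And>x. x \<in> {0..1} \<Longrightarrow> h (0, x) = p x" "\<And>x. x \<in> {0..1} \<Longrightarrow> h (1, x) = q x"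
    "\<And>t. t \<in> {0..1} \<Longrightarrow> h (t, 0) = p 0" "\<And>t. t \<in> {0..1} \<Longrightarrow> h (t, 1) = p 1"
    using path_homotopicE[OF assms(1)] by blast
  show ?thesis
    by (rule path_homotopicI[OF continuous_map_compose[OF h(1) assms(2)]]) (simp_all add: h)
qed

text \<open>
  The straight-line homotopy between the two parameter functions. Associativity, units and inverses
  below are all obtained by writing both sides as reparametrizations of one path.
\<close>

lemma path_homotopic_reparametrize:
  assumes "pathin X g" "continuous_on {0..1} \<phi>" "continuous_on {0..1} \<psi>"
    and "\<phi> ` {0..1} \<subseteq> {0..1}" "\<psi> ` {0..1} \<subseteq> {0..1}"
    and "\<phi> 0 = \<psi> 0" "\<phi> 1 = \<psi> 1"
  shows "path_homotopic X (g \<circ> \<phi>) (g \<circ> \<psi>)"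
proof -
  let ?Q = "{0..1} \<times> {0..1} :: (real \<times> real) set"
  let ?m = "\<lambda>z. (1 - fst z) * \<phi> (snd z) + fst z * \<psi> (snd z)"
  have 1: "continuous_on ?Q ?m"
    by (intro continuous_intros continuous_on_compose2[OF assms(2)]
        continuous_on_compose2[OF assms(3)]) auto
  have 2: "?m z \<in> {0..1}" if "z \<in> ?Q" for z
    using that convexD[of "{0..1::real}" "\<phi> (snd z)" "\<psi> (snd z)" "1 - fst z" "fst z"] assms(4,5)
    by (auto simp: image_subset_iff)
  have "continuous_map (top_of_set ?Q) (top_of_set {0..1}) ?m"
    using 1 2 by auto
  then have "continuous_map (top_of_set ?Q) X (g \<circ> ?m)"
    using assms(1) continuous_map_compose pathin_def by blast
  then show ?thesis
    by (rule path_homotopicI) (use assms(6,7) in \<open>simp_all flip: distrib_right\<close>)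
qed

lemma path_homotopic_join:
  assumes "path_homotopic X p p'" "path_homotopic X q q'" "p 1 = q 0"
  shows "path_homotopic X (loop_join p q) (loop_join p' q')"
proof -
  let ?Q = "top_of_set ({0..1} \<times> {0..1}) :: (real \<times> real) topology"
  obtain h where h: "continuous_map ?Q X h"
    "\<And>x. x \<in> {0..1} \<Longrightarrow> h (0, x) = p x" "\<And>x. x \<in> {0..1} \<Longrightarrow> h (1, x) = p' x"
    "\<And>t. t \<in> {0..1} \<Longrightarrow> h (t, 0) = p 0" "\<And>t. t \<in> {0..1} \<Longrightarrow> h (t, 1) = p 1"
    using path_homotopicE[OF assms(1)] by blast
  obtain k where k: "continuous_map ?Q X k"
    "\<And>x. x \<in> {0..1} \<Longrightarrow> k (0, x) = q x" "\<And>x. x \<in> {0..1} \<Longrightarrow> k (1, x) = q' x"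
    "\<And>t. t \<in> {0..1} \<Longrightarrow> k (t, 0) = q 0" "\<And>t. t \<in> {0..1} \<Longrightarrow> k (t, 1) = q 1"
    using path_homotopicE[OF assms(2)] by blast
  let ?m = "\<lambda>z. if snd z \<le> 1/2 then h (fst z, 2 * snd z) else k (fst z, 2 * snd z - 1)"
  have "continuous_map ?Q X ?m"
  proof (rule continuous_map_cases_le)
    show "continuous_map ?Q euclideanreal snd"
      by (auto intro!: continuous_intros)
    show "continuous_map ?Q euclideanreal (\<lambda>z. 1/2)"
      by simp
    show "continuous_map (subtopology ?Q {z \<in> topspace ?Q. snd z \<le> 1/2}) X (\<lambda>z. h (fst z, 2 * snd z))"
      by (rule continuous_map_compose[OF _ h(1), unfolded o_def])
        (auto simp: subtopology_subtopology intro!: continuous_intros)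
    show "continuous_map (subtopology ?Q {z \<in> topspace ?Q. 1/2 \<le> snd z}) X (\<lambda>z. k (fst z, 2 * snd z - 1))"
      by (rule continuous_map_compose[OF _ k(1), unfolded o_def])
        (auto simp: subtopology_subtopology intro!: continuous_intros)
    show "h (fst z, 2 * snd z) = k (fst z, 2 * snd z - 1)"
      if "z \<in> topspace ?Q" "snd z = 1/2" for z
    proof -
      have *: "2 * snd z = 1" and "fst z \<in> {0..1}"
        using that by auto
      then show ?thesis
        unfolding * using h(5)[of "fst z"] k(4)[of "fst z"] assms(3) by simp
    qed
  qed
  then show ?thesis
    by (rule path_homotopicI) (simp_all add: h k loop_join_def)
qed

lemma loop_join_ends [simp]: "loop_join p q 0 = p 0" "loop_join p q 1 = q 1"
  by (simp_all add: loop_join_def)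

lemma path_rev_ends [simp]: "path_rev p 0 = p 1" "path_rev p 1 = p 0"
  by (simp_all add: path_rev_def)

lemma path_rev_rev [simp]: "path_rev (path_rev p) = p"
  by (simp add: path_rev_def)

lemma compose_loop_join: "f \<circ> loop_join p q = loop_join (f \<circ> p) (f \<circ> q)"
  by (auto simp: loop_join_def)

lemma pathin_join: "pathin X p \<Longrightarrow> pathin X q \<Longrightarrow> p 1 = q 0 \<Longrightarrow> pathin X (loop_join p q)"
  by (meson path_homotopic_imp_pathin(1) path_homotopic_join path_homotopic_refl)

lemma pathin_rev:
  assumes "pathin X p"
  shows "pathin X (path_rev p)"
proof -
  have "path_homotopic X (p \<circ> (\<lambda>x. 1 - x)) (p \<circ> (\<lambda>x. 1 - x))"
    by (rule path_homotopic_reparametrize[OF assms]) (auto intro!: continuous_intros)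
  then show ?thesis
    using path_homotopic_imp_pathin by (force simp: path_rev_def o_def)
qed

lemma path_homotopic_assoc:
  assumes "pathin X p" "pathin X q" "pathin X s" "p 1 = q 0" "q 1 = s 0"
  shows "path_homotopic X (loop_join (loop_join p q) s) (loop_join p (loop_join q s))"
proof -
  let ?g = "loop_join (loop_join p q) s"
  \<comment> \<open>The change of parameter has slopes \<open>1/2\<close>, \<open>1\<close>, \<open>2\<close> on its three pieces; being convex, it is the maximum of the three linear functions.\<close>
  let ?\<phi> = "\<lambda>x::real. max (x/2) (max (x - 1/4) (2 * x - 1))"
  have "loop_join p (loop_join q s) x = (?g \<circ> ?\<phi>) x" for x
  proof -
    consider "x \<le> 1/2" | "1/2 < x" "x \<le> 3/4" | "3/4 < x"
      by linarith
    then show ?thesis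
    proof cases
      case 1
      then have "?\<phi> x = x/2" by simp
      with 1 show ?thesis by (simp add: loop_join_def)
    next
      case 2
      then have "?\<phi> x = x - 1/4" by simp
      with 2 show ?thesis by (simp add: loop_join_def algebra_simps)
    next
      case 3
      then have "?\<phi> x = 2 * x - 1" by simp
      with 3 show ?thesis by (simp add: loop_join_def)
    qed
  qed
  then have "loop_join p (loop_join q s) = ?g \<circ> ?\<phi>"
    by blast
  moreover have "path_homotopic X (?g \<circ> id) (?g \<circ> ?\<phi>)"
    by (rule path_homotopic_reparametrize)
      (auto simp: pathin_join assms le_max_iff_disj intro!: continuous_intros)
  ultimately show ?thesis
    by simp
qed

lemma path_homotopic_const_join:
  assumes "pathin X p"
  shows "path_homotopic X (loop_join (\<lambda>t. p 0) p) p"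
proof -
  have "loop_join (\<lambda>t. p 0) p = p \<circ> (\<lambda>x. max 0 (2 * x - 1))"
  proof
    have *: "max 0 (2 * x - 1) = (if x \<le> 1/2 then 0 else 2 * x - 1)" for x :: real
      by auto
    show "loop_join (\<lambda>t. p 0) p x = (p \<circ> (\<lambda>x. max 0 (2 * x - 1))) x" for x
      unfolding o_def * by (simp add: loop_join_def)
  qed
  moreover have "path_homotopic X (p \<circ> (\<lambda>x. max 0 (2 * x - 1))) (p \<circ> id)"
    by (rule path_homotopic_reparametrize[OF assms]) (auto intro!: continuous_intros)
  ultimately show ?thesis
    by simp
qed

lemma path_homotopic_join_const:
  assumes "pathin X p"
  shows "path_homotopic X (loop_join p (\<lambda>t. p 1)) p"
proof -
  have "loop_join p (\<lambda>t. p 1) = p \<circ> (\<lambda>x. min 1 (2 * x))"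
  proof
    have *: "min 1 (2 * x) = (if x \<le> 1/2 then 2 * x else 1)" for x :: real
      by auto
    show "loop_join p (\<lambda>t. p 1) x = (p \<circ> (\<lambda>x. min 1 (2 * x))) x" for x
      unfolding o_def * by (simp add: loop_join_def)
  qed
  moreover have "path_homotopic X (p \<circ> (\<lambda>x. min 1 (2 * x))) (p \<circ> id)"
    by (rule path_homotopic_reparametrize[OF assms]) (auto intro!: continuous_intros)
  ultimately show ?thesis
    by simp
qed

lemma path_homotopic_rev_join:
  assumes "pathin X p"
  shows "path_homotopic X (loop_join (path_rev p) p) (\<lambda>t. p 1)"
proof -
  have "loop_join (path_rev p) p = p \<circ> (\<lambda>x. \<bar>1 - 2 * x\<bar>)"
    by (auto simp: loop_join_def path_rev_def fun_eq_iff abs_if)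
  moreover have "path_homotopic X (p \<circ> (\<lambda>x. \<bar>1 - 2 * x\<bar>)) (p \<circ> (\<lambda>x. 1))"
    by (rule path_homotopic_reparametrize[OF assms]) (auto intro!: continuous_intros)
  moreover have "p \<circ> (\<lambda>x::real. 1) = (\<lambda>x. p 1)"
    by (simp add: fun_eq_iff)
  ultimately show ?thesis
    by simp
qed

lemma path_homotopic_join_rev:
  assumes "pathin X p"
  shows "path_homotopic X (loop_join p (path_rev p)) (\<lambda>t. p 0)"
  using path_homotopic_rev_join[OF pathin_rev[OF assms]] by simp

text \<open>
  The two cancellation rules replace computations in the fundamental groupoid.
\<close>

lemma path_homotopic_cancel_left:
  assumes r: "pathin X r" and p: "pathin X p" and rp: "r 1 = p 0"
  shows "path_homotopic X (loop_join (path_rev r) (loop_join r p)) p"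
proof -
  have "path_homotopic X (loop_join (path_rev r) (loop_join r p)) (loop_join (loop_join (path_rev r) r) p)"
    by (rule path_homotopic_sym[OF path_homotopic_assoc]) (simp_all add: rp r p pathin_rev)
  also have "path_homotopic X \<dots> (loop_join (\<lambda>t. p 0) p)"
    using path_homotopic_rev_join[OF r] rp by (intro path_homotopic_join path_homotopic_refl p) simp_all
  also have "path_homotopic X \<dots> p"
    by (rule path_homotopic_const_join[OF p])
  finally show ?thesis .
qed

lemma path_homotopic_cancel_right:
  assumes r: "pathin X r" and p: "pathin X p" and pr: "p 1 = r 0"
  shows "path_homotopic X (loop_join (loop_join p r) (path_rev r)) p"
proof -
  have "path_homotopic X (loop_join (loop_join p r) (path_rev r)) (loop_join p (loop_join r (path_rev r)))"
    by (intro path_homotopic_assoc pathin_rev r p) (simp_all add: pr)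
  also have "path_homotopic X \<dots> (loop_join p (\<lambda>t. p 1))"
    using path_homotopic_join_rev[OF r] pr by (intro path_homotopic_join path_homotopic_refl p) simp_all
  also have "path_homotopic X \<dots> p"
    by (rule path_homotopic_join_const[OF p])
  finally show ?thesis .
qed

section \<open>The fundamental group of a covering\<close>

text \<open>
  Lift the square that realises the homotopy. By uniqueness of lifts its sides \<open>t = 0\<close> and \<open>t = 1\<close> are
  the given lifts and the other two sides are constant; in particular the two lifts have the same
  end point.
\<close>

lemma homotopy_lifting:
  assumes p: "proper_local_homeomorphism E B p" and uv: "path_homotopic B u v"
    and k: "pathin E k" "\<And>t. t \<in> {0..1} \<Longrightarrow> p (k t) = u t"
    and l: "pathin E l" "\<And>t. t \<in> {0..1} \<Longrightarrow> p (l t) = v t"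
    and kl: "k 0 = l 0"
  shows "path_homotopic E k l"
proof -
  let ?I = "top_of_set {0..1::real}"
  obtain h where h: "continuous_map (top_of_set ({0..1::real} \<times> {0..1::real})) B h"
    "\<And>x. x \<in> {0..1} \<Longrightarrow> h (0, x) = u x" "\<And>x. x \<in> {0..1} \<Longrightarrow> h (1, x) = v x"
    "\<And>t. t \<in> {0..1} \<Longrightarrow> h (t, 0) = u 0" "\<And>t. t \<in> {0..1} \<Longrightarrow> h (t, 1) = u 1"
    using path_homotopicE[OF uv] by blast
  have kE: "k t \<in> topspace E" if "t \<in> {0..1}" for t
    using k(1) that by (auto simp: pathin_def continuous_map_def)
  obtain m where m: "continuous_map (top_of_set ({0..1} \<times> {0..1})) E m" "m (0, 0) = k 0"
    "\<And>z. z \<in> {0..1} \<times> {0..1} \<Longrightarrow> p (m z) = h z"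
    using square_lifting[OF p h(1), of "k 0"] kE[of 0] h(2)[of 0] k(2)[of 0] by auto
  have side: "g t = g' t"
    if "continuous_map ?I E g" "continuous_map ?I E g'" "\<And>t. t \<in> {0..1} \<Longrightarrow> p (g t) = p (g' t)"
      "g 0 = g' 0" "t \<in> {0..1}" for g g' t
  proof (rule lift_unique[OF p _ that(1,2), of 0])
    show "connected_space ?I"
      by (metis connectedin_def connectedin_iff_connected connected_Icc)
  qed (use that in auto)
  have horizontal: "continuous_map ?I E (\<lambda>t. m (t, x))" and vertical: "continuous_map ?I E (\<lambda>t. m (x, t))"
    if "x \<in> {0..1}" for x
    using that by (auto intro!: continuous_map_compose[OF _ m(1), unfolded o_def] continuous_intros)
  have const: "continuous_map ?I E (\<lambda>t. k x)" if "x \<in> {0..1}" for x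
    using kE[OF that] by simp
  have kc: "continuous_map ?I E k" and lc: "continuous_map ?I E l"
    using k(1) l(1) by (simp_all add: pathin_def)
  have bottom: "m (t, 0) = k 0" if t: "t \<in> {0..1}" for t
  proof (rule side[OF horizontal const _ _ t])
    show "p (m (t, 0)) = p (k 0)" if "t \<in> {0..1}" for t
      using m(3)[of "(t, 0)"] h(4)[OF that] that k(2)[of 0] by simp
  qed (use m(2) in simp_all)
  have left: "m (0, t) = k t" if t: "t \<in> {0..1}" for t
  proof (rule side[OF vertical kc _ _ t])
    show "p (m (0, t)) = p (k t)" if "t \<in> {0..1}" for t
      using m(3)[of "(0, t)"] h(2)[OF that] that k(2)[OF that] by simp
  qed (use m(2) in simp_all)
  have right: "m (1, t) = l t" if t: "t \<in> {0..1}" for t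
  proof (rule side[OF vertical lc _ _ t])
    show "p (m (1, t)) = p (l t)" if "t \<in> {0..1}" for t
      using m(3)[of "(1, t)"] h(3)[OF that] that l(2)[OF that] by simp
  qed (use bottom[of 1] kl in simp_all)
  have top: "m (t, 1) = k 1" if t: "t \<in> {0..1}" for t
  proof (rule side[OF horizontal const _ _ t])
    show "p (m (t, 1)) = p (k 1)" if "t \<in> {0..1}" for t
      using m(3)[of "(t, 1)"] h(5)[OF that] that k(2)[of 1] by simp
  qed (use left[of 1] in simp_all)
  show ?thesis
    by (rule path_homotopicI[OF m(1) left right bottom top])
qed

lemma loop_homotopy_iff:
  "(p, q) \<in> loop_homotopy X a \<longleftrightarrow> path_homotopic X p q \<and> p 0 = a \<and> p 1 = a"
proof
  assume "(p, q) \<in> loop_homotopy X a"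
  moreover from this have "p 0 = a" "p 1 = a"
    using loop_homotopy_imp_loops by (fastforce simp: loops_at_def)+
  ultimately show "path_homotopic X p q \<and> p 0 = a \<and> p 1 = a"
    by (simp add: loop_homotopy_def path_homotopic_def)
qed (auto simp: loop_homotopy_def path_homotopic_def)

abbreviation loop_class :: "'a topology \<Rightarrow> 'a \<Rightarrow> (real \<Rightarrow> 'a) \<Rightarrow> (real \<Rightarrow> 'a) set"
  where "loop_class X a p \<equiv> loop_homotopy X a `` {p}"

lemma loop_class_eq_iff:
  assumes "p \<in> loops_at X a" "q \<in> loops_at X a"
  shows "loop_class X a p = loop_class X a q \<longleftrightarrow> path_homotopic X p q"
  using eq_equiv_class_iff[OF equiv_loop_homotopy assms] assms
  by (auto simp: loop_homotopy_iff loops_at_def)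

lemma carrier_fundamental_group:
  "carrier (fundamental_group X a) = loop_class X a ` loops_at X a"
  by (auto simp: fundamental_group_def quotient_def)

lemma loop_join_in_loops:
  "p \<in> loops_at X a \<Longrightarrow> q \<in> loops_at X a \<Longrightarrow> loop_join p q \<in> loops_at X a"
  by (auto simp: loops_at_def pathin_join)

lemma mult_fundamental_group:
  assumes p: "p \<in> loops_at X a" and q: "q \<in> loops_at X a"
  shows "loop_class X a p \<otimes>\<^bsub>fundamental_group X a\<^esub> loop_class X a q = loop_class X a (loop_join p q)"
proof -
  let ?R = "loop_homotopy X a"
  have "?R `` {loop_join p' q'} = ?R `` {loop_join p q}" if "(p, p') \<in> ?R" "(q, q') \<in> ?R" for p' q'
    using that equiv_loop_homotopy by (metis equiv_class_eq loop_homotopy_join)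
  then have "(\<Union>p'\<in>?R `` {p}. \<Union>q'\<in>?R `` {q}. ?R `` {loop_join p' q'}) =
      (\<Union>p'\<in>?R `` {p}. \<Union>q'\<in>?R `` {q}. ?R `` {loop_join p q})"
    by (intro SUP_cong) auto
  also have "\<dots> = ?R `` {loop_join p q}"
    using equiv_class_self[OF equiv_loop_homotopy p] equiv_class_self[OF equiv_loop_homotopy q] by blast
  finally show ?thesis
    by (simp add: fundamental_group_def)
qed

text \<open>
  A map on loops that preserves and reflects homotopy and respects concatenation up to homotopy
  induces an injective homomorphism. Both the change of base point and the projection of a covering
  are of this kind.
\<close>

lemma loop_map_iso_image:
  assumes a: "a \<in> topspace X" and b: "b \<in> topspace Y"
    and F: "\<And>p. p \<in> loops_at X a \<Longrightarrow> F p \<in> loops_at Y b"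
    and hom: "\<And>p q. p \<in> loops_at X a \<Longrightarrow> q \<in> loops_at X a \<Longrightarrow>
      path_homotopic Y (F (loop_join p q)) (loop_join (F p) (F q))"
    and iff: "\<And>p q. p \<in> loops_at X a \<Longrightarrow> q \<in> loops_at X a \<Longrightarrow>
      path_homotopic Y (F p) (F q) \<longleftrightarrow> path_homotopic X p q"
    and H: "H = (\<lambda>p. loop_class Y b (F p)) ` loops_at X a"
  shows "subgroup H (fundamental_group Y b)"
    and "fundamental_group X a \<cong> (fundamental_group Y b)\<lparr>carrier := H\<rparr>"
proof -
  let ?G = "fundamental_group X a" and ?G' = "fundamental_group Y b"
  define \<Phi> where "\<Phi> = (\<lambda>P. loop_class Y b (F (SOME p. p \<in> P)))"
  have \<Phi>: "\<Phi> (loop_class X a p) = loop_class Y b (F p)" if p: "p \<in> loops_at X a" for p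
  proof -
    define q where "q = (SOME q. q \<in> loop_class X a p)"
    have "p \<in> loop_class X a p"
      using equiv_class_self[OF equiv_loop_homotopy p] .
    then have "q \<in> loop_class X a p"
      unfolding q_def by (rule someI[of "\<lambda>q. q \<in> loop_class X a p"])
    then have pq: "(p, q) \<in> loop_homotopy X a"
      by simp
    then have "path_homotopic X p q" "q \<in> loops_at X a"
      by (simp add: loop_homotopy_iff) (rule loop_homotopy_imp_loops(2)[OF pq])
    then have "path_homotopic Y (F p) (F q)"
      using iff p by blast
    then have "loop_class Y b (F p) = loop_class Y b (F q)"
      using loop_class_eq_iff F p \<open>q \<in> loops_at X a\<close> by metis
    then show ?thesis
      by (simp add: \<Phi>_def q_def)
  qed
  have image: "\<Phi> ` carrier ?G = H"
    using \<Phi> by (force simp: carrier_fundamental_group H image_image)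
  have hom\<Phi>: "\<Phi> \<in> hom ?G ?G'"
  proof (rule homI)
    show "\<Phi> P \<in> carrier ?G'" if "P \<in> carrier ?G" for P
      using that F \<Phi> by (auto simp: carrier_fundamental_group)
    show "\<Phi> (P \<otimes>\<^bsub>?G\<^esub> Q) = \<Phi> P \<otimes>\<^bsub>?G'\<^esub> \<Phi> Q" if PQ: "P \<in> carrier ?G" "Q \<in> carrier ?G" for P Q
    proof -
      obtain p q where pq: "p \<in> loops_at X a" "q \<in> loops_at X a" "P = loop_class X a p" "Q = loop_class X a q"
        using PQ by (auto simp: carrier_fundamental_group)
      have "loop_class Y b (F (loop_join p q)) = loop_class Y b (loop_join (F p) (F q))"
        using loop_class_eq_iff hom F loop_join_in_loops pq by metis
      then show ?thesis
        using pq F by (simp add: mult_fundamental_group \<Phi> loop_join_in_loops)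
    qed
  qed
  have inj: "inj_on \<Phi> (carrier ?G)"
  proof (rule inj_onI)
    fix P Q assume "P \<in> carrier ?G" "Q \<in> carrier ?G" and eq: "\<Phi> P = \<Phi> Q"
    then obtain p q where pq: "p \<in> loops_at X a" "q \<in> loops_at X a" "P = loop_class X a p" "Q = loop_class X a q"
      by (auto simp: carrier_fundamental_group)
    then have "path_homotopic Y (F p) (F q)"
      using eq \<Phi> loop_class_eq_iff F by metis
    then show "P = Q"
      using pq iff loop_class_eq_iff by metis
  qed
  have gh: "group_hom ?G ?G' \<Phi>"
    using group_fundamental_group[OF a] group_fundamental_group[OF b] hom\<Phi>
    by (simp add: group_hom_def group_hom_axioms_def)
  show "subgroup H ?G'"
    using group_hom.img_is_subgroup[OF gh] image by simp
  have "\<Phi> \<in> iso ?G (?G'\<lparr>carrier := H\<rparr>)"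
    unfolding iso_def bij_betw_def using hom\<Phi> inj image by (auto simp: hom_def)
  then show "?G \<cong> ?G'\<lparr>carrier := H\<rparr>"
    unfolding is_iso_def by blast
qed

text \<open>
  The isomorphism conjugates a loop by the path \<open>\<gamma>\<close>.
\<close>

lemma fundamental_group_basepoint_iso:
  assumes \<gamma>: "pathin X \<gamma>" and ab: "\<gamma> 0 = a" "\<gamma> 1 = b"
  shows "fundamental_group X a \<cong> fundamental_group X b"
proof -
  have top: "a \<in> topspace X" "b \<in> topspace X"
    using \<gamma> ab by (force simp: pathin_def continuous_map_def)+
  define F where "F = (\<lambda>p. loop_join (path_rev \<gamma>) (loop_join p \<gamma>))"
  have L: "pathin X p" "p 0 = c" "p 1 = c" if "p \<in> loops_at X c" for p c
    using that by (auto simp: loops_at_def)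
  have rev: "pathin X (path_rev \<gamma>)"
    by (rule pathin_rev[OF \<gamma>])
  have F: "F p \<in> loops_at X b" if "p \<in> loops_at X a" for p
    using L[OF that] ab \<gamma> rev by (auto simp: F_def loops_at_def intro!: pathin_join)
  have conj_inv: "path_homotopic X (loop_join \<gamma> (loop_join (F p) (path_rev \<gamma>))) p" if p: "p \<in> loops_at X a" for p
  proof -
    have pg: "pathin X (loop_join p \<gamma>)"
      using L[OF p] ab \<gamma> by (intro pathin_join) auto
    have "path_homotopic X (loop_join \<gamma> (loop_join (F p) (path_rev \<gamma>))) (loop_join (loop_join \<gamma> (F p)) (path_rev \<gamma>))"
      using L[OF F[OF p]] ab by (intro path_homotopic_sym[OF path_homotopic_assoc] \<gamma> rev) auto
    also have "path_homotopic X \<dots> (loop_join (loop_join p \<gamma>) (path_rev \<gamma>))"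
    proof (rule path_homotopic_join[OF _ path_homotopic_refl[OF rev]])
      show "path_homotopic X (loop_join \<gamma> (F p)) (loop_join p \<gamma>)"
        using path_homotopic_cancel_left[OF rev pg] L[OF p] ab by (simp add: F_def)
    qed (use L[OF F[OF p]] ab in auto)
    also have "path_homotopic X \<dots> p"
      using L[OF p] ab by (intro path_homotopic_cancel_right \<gamma>) auto
    finally show ?thesis .
  qed
  have iff: "path_homotopic X (F p) (F q) \<longleftrightarrow> path_homotopic X p q"
    if p: "p \<in> loops_at X a" and q: "q \<in> loops_at X a" for p q
  proof
    assume pq: "path_homotopic X (F p) (F q)"
    have "path_homotopic X p (loop_join \<gamma> (loop_join (F p) (path_rev \<gamma>)))"
      by (rule path_homotopic_sym[OF conj_inv[OF p]])
    also have "path_homotopic X \<dots> (loop_join \<gamma> (loop_join (F q) (path_rev \<gamma>)))"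
      using L[OF F[OF p]] ab by (intro path_homotopic_join path_homotopic_refl \<gamma> rev pq) auto
    also have "path_homotopic X \<dots> q"
      by (rule conj_inv[OF q])
    finally show "path_homotopic X p q" .
  next
    assume "path_homotopic X p q"
    then show "path_homotopic X (F p) (F q)"
      unfolding F_def using L[OF p] ab by (intro path_homotopic_join path_homotopic_refl \<gamma> rev) auto
  qed
  have hom: "path_homotopic X (F (loop_join p q)) (loop_join (F p) (F q))"
    if p: "p \<in> loops_at X a" and q: "q \<in> loops_at X a" for p q
  proof -
    note Lp = L[OF p] and Lq = L[OF q]
    have paths: "pathin X (loop_join p \<gamma>)" "pathin X (loop_join q \<gamma>)"
      using Lp Lq ab \<gamma> by (auto intro!: pathin_join)
    have "path_homotopic X (loop_join (F p) (F q)) (loop_join (path_rev \<gamma>) (loop_join (loop_join p \<gamma>) (F q)))"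
      unfolding F_def using Lp Lq ab \<gamma> rev by (intro path_homotopic_assoc pathin_join) auto
    also have "path_homotopic X \<dots> (loop_join (path_rev \<gamma>) (loop_join p (loop_join \<gamma> (F q))))"
      using Lp ab L[OF F[OF q]] paths
      by (intro path_homotopic_join[OF path_homotopic_refl[OF rev] path_homotopic_assoc] \<gamma>) auto
    also have "path_homotopic X \<dots> (loop_join (path_rev \<gamma>) (loop_join p (loop_join q \<gamma>)))"
    proof (intro path_homotopic_join[OF path_homotopic_refl[OF rev] path_homotopic_join[OF path_homotopic_refl[OF Lp(1)]]])
      show "path_homotopic X (loop_join \<gamma> (F q)) (loop_join q \<gamma>)"
        using path_homotopic_cancel_left[OF rev paths(2)] Lq ab by (simp add: F_def)
    qed (use Lp ab in auto)
    also have "path_homotopic X \<dots> (F (loop_join p q))"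
      unfolding F_def using Lp Lq ab
      by (intro path_homotopic_join[OF path_homotopic_refl[OF rev] path_homotopic_sym[OF path_homotopic_assoc]] \<gamma>) auto
    finally show ?thesis
      by (rule path_homotopic_sym)
  qed
  have onto: "carrier (fundamental_group X b) = (\<lambda>p. loop_class X b (F p)) ` loops_at X a"
  proof
    show "carrier (fundamental_group X b) \<subseteq> (\<lambda>p. loop_class X b (F p)) ` loops_at X a"
    proof
      fix Q assume "Q \<in> carrier (fundamental_group X b)"
      then obtain q where q: "q \<in> loops_at X b" "Q = loop_class X b q"
        by (auto simp: carrier_fundamental_group)
      note Lq = L[OF q(1)]
      define p where "p = loop_join \<gamma> (loop_join q (path_rev \<gamma>))"
      have p: "p \<in> loops_at X a"
        using Lq ab \<gamma> rev by (auto simp: p_def loops_at_def intro!: pathin_join)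
      have "path_homotopic X (loop_join p \<gamma>) (loop_join \<gamma> (loop_join (loop_join q (path_rev \<gamma>)) \<gamma>))"
        unfolding p_def using Lq ab rev by (intro path_homotopic_assoc pathin_join \<gamma>) auto
      also have "path_homotopic X \<dots> (loop_join \<gamma> q)"
        using path_homotopic_cancel_right[OF rev Lq(1)] Lq ab
        by (intro path_homotopic_join path_homotopic_refl \<gamma>) auto
      finally have "path_homotopic X (F p) (loop_join (path_rev \<gamma>) (loop_join \<gamma> q))"
        unfolding F_def using ab L[OF p] by (intro path_homotopic_join[OF path_homotopic_refl[OF rev]]) auto
      also have "path_homotopic X \<dots> q"
        using Lq ab by (intro path_homotopic_cancel_left \<gamma>) auto
      finally have "Q = loop_class X b (F p)"
        using q F[OF p] loop_class_eq_iff by metis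
      then show "Q \<in> (\<lambda>p. loop_class X b (F p)) ` loops_at X a"
        using p by blast
    qed
  qed (use F in \<open>auto simp: carrier_fundamental_group\<close>)
  have "fundamental_group X a \<cong> (fundamental_group X b)\<lparr>carrier := carrier (fundamental_group X b)\<rparr>"
    by (rule loop_map_iso_image(2)[OF top F hom iff onto])
  then show ?thesis
    by simp
qed

text \<open>
  Injectivity is the lifting of homotopies. The index is finite because the end point of the lift
  of a loop starting at \<open>e\<close> lies in the finite fibre of \<open>p e\<close> and determines the coset of the loop.
\<close>

lemma covering_fundamental_group:
  assumes p: "proper_local_homeomorphism E B p" and e: "e \<in> topspace E"
    and H: "H = (\<lambda>l. loop_class B (p e) (p \<circ> l)) ` loops_at E e"
  shows "subgroup H (fundamental_group B (p e))"
    and "fundamental_group E e \<cong> (fundamental_group B (p e))\<lparr>carrier := H\<rparr>"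
    and "finite (rcosets\<^bsub>fundamental_group B (p e)\<^esub> H)"
proof -
  let ?G = "fundamental_group B (p e)"
  note D = proper_local_homeomorphismD[OF p]
  have be: "p e \<in> topspace B"
    using D(7) e .
  interpret G: group ?G
    by (rule group_fundamental_group[OF be])
  have L: "p \<circ> l \<in> loops_at B (p e)" if "l \<in> loops_at E e" for l
    using that continuous_map_compose[OF _ D(2)] by (auto simp: loops_at_def pathin_def)
  have iff: "path_homotopic B (p \<circ> l) (p \<circ> m) \<longleftrightarrow> path_homotopic E l m"
    if "l \<in> loops_at E e" "m \<in> loops_at E e" for l m
    using homotopy_lifting[OF p, of "p \<circ> l" "p \<circ> m" l m] path_homotopic_compose[OF _ D(2)] that
    by (auto simp: loops_at_def)
  have hom: "path_homotopic B (p \<circ> loop_join l m) (loop_join (p \<circ> l) (p \<circ> m))"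
    if "l \<in> loops_at E e" "m \<in> loops_at E e" for l m
    using L loop_join_in_loops that
    by (metis (no_types, lifting) compose_loop_join loops_at_def mem_Collect_eq path_homotopic_refl)
  show sub: "subgroup H ?G" and "fundamental_group E e \<cong> ?G\<lparr>carrier := H\<rparr>"
    using loop_map_iso_image[OF e be L hom iff H] by blast+
  \<comment> \<open>A coset is determined by the end point of the lift of a representing loop.\<close>
  define ends where "ends = (\<lambda>q x. \<exists>k. pathin E k \<and> k 0 = e \<and> k 1 = x \<and> (\<forall>t\<in>{0..1}. p (k t) = q t))"
  define coset where "coset = (\<lambda>x. H #>\<^bsub>?G\<^esub> loop_class B (p e) (SOME q. q \<in> loops_at B (p e) \<and> ends q x))"
  have same: "H #>\<^bsub>?G\<^esub> loop_class B (p e) q = H #>\<^bsub>?G\<^esub> loop_class B (p e) r"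
    if q: "q \<in> loops_at B (p e)" "ends q x" and r: "r \<in> loops_at B (p e)" "ends r x" for q r x
  proof -
    obtain k where k: "pathin E k" "k 0 = e" "k 1 = x" "\<And>t. t \<in> {0..1} \<Longrightarrow> p (k t) = q t"
      using q(2) by (auto simp: ends_def)
    obtain m where m: "pathin E m" "m 0 = e" "m 1 = x" "\<And>t. t \<in> {0..1} \<Longrightarrow> p (m t) = r t"
      using r(2) by (auto simp: ends_def)
    define l where "l = loop_join k (path_rev m)"
    have l: "l \<in> loops_at E e"
      using k m by (auto simp: l_def loops_at_def intro!: pathin_join pathin_rev)
    have pk: "pathin B (p \<circ> k)" and pm: "pathin B (p \<circ> m)"
      using k m D(2) continuous_map_compose by (auto simp: pathin_def)
    have "path_homotopic B (loop_join (p \<circ> l) r) (loop_join (p \<circ> l) (p \<circ> m))"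
    proof (rule path_homotopic_join)
      show "path_homotopic B r (p \<circ> m)"
        by (intro path_homotopic_sym[OF path_homotopic_eq] pm) (simp add: m)
    qed (use L[OF l] r in \<open>auto simp: loops_at_def intro!: path_homotopic_refl\<close>)
    also have "loop_join (p \<circ> l) (p \<circ> m) = p \<circ> loop_join l m"
      by (simp add: compose_loop_join)
    also have "path_homotopic B (p \<circ> loop_join l m) (p \<circ> k)"
      using path_homotopic_cancel_right[OF pathin_rev[OF m(1)] k(1)] k m
      by (intro path_homotopic_compose[OF _ D(2)]) (simp add: l_def)
    also have "path_homotopic B (p \<circ> k) q"
      by (intro path_homotopic_eq pk) (simp add: k)
    finally have "loop_class B (p e) q = loop_class B (p e) (loop_join (p \<circ> l) r)"
      using loop_class_eq_iff q r L[OF l] loop_join_in_loops by metis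
    also have "\<dots> = loop_class B (p e) (p \<circ> l) \<otimes>\<^bsub>?G\<^esub> loop_class B (p e) r"
      by (simp add: mult_fundamental_group L[OF l] r)
    finally have "loop_class B (p e) q \<in> H #>\<^bsub>?G\<^esub> loop_class B (p e) r"
      using l by (auto simp: r_coset_def H)
    then show ?thesis
      using G.repr_independence[OF _ _ sub] r(1) by (metis carrier_fundamental_group imageI)
  qed
  have "rcosets\<^bsub>?G\<^esub> H \<subseteq> coset ` {x \<in> topspace E. p x = p e}"
  proof
    fix R assume "R \<in> rcosets\<^bsub>?G\<^esub> H"
    then obtain q where q: "q \<in> loops_at B (p e)" "R = H #>\<^bsub>?G\<^esub> loop_class B (p e) q"
      by (auto simp: RCOSETS_def carrier_fundamental_group)
    have q': "pathin B q" "q 0 = p e" "q 1 = p e"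
      using q(1) by (auto simp: loops_at_def)
    obtain k where k: "pathin E k" "k 0 = e" "\<And>t. t \<in> {0..1} \<Longrightarrow> p (k t) = q t"
      using path_lifting[OF p q'(1) e] q'(2) by auto
    then have ends: "ends q (k 1)"
      by (auto simp: ends_def)
    have "R = coset (k 1)"
      unfolding coset_def q(2)
    proof (rule someI2[of _ q])
      show "H #>\<^bsub>?G\<^esub> loop_class B (p e) q = H #>\<^bsub>?G\<^esub> loop_class B (p e) r"
        if "r \<in> loops_at B (p e) \<and> ends r (k 1)" for r
        using same[OF q(1) ends] that by blast
    qed (use q(1) ends in blast)
    moreover have "k 1 \<in> topspace E" "p (k 1) = p e"
      using k q' by (auto simp: pathin_def continuous_map_def)
    ultimately show "R \<in> coset ` {x \<in> topspace E. p x = p e}"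
      by blast
  qed
  then show "finite (rcosets\<^bsub>?G\<^esub> H)"
    using finite_fibre[OF p be] finite_surj by blast
qed

text \<open>
  If every loop at \<open>p e\<close> is homotopic to the projection of a loop, then every path from \<open>e\<close> into the
  fibre of \<open>p e\<close> is closed, so this fibre is the single point \<open>e\<close>. Two points \<open>a\<close>, \<open>b\<close> of another
  fibre are compared by transporting \<open>b\<close> to the fibre of \<open>p e\<close> along the projection of a path from \<open>a\<close>
  to \<open>e\<close>.
\<close>

lemma covering_injective:
  assumes p: "proper_local_homeomorphism E B p" and E: "path_connected_space E" and e: "e \<in> topspace E"
    and full: "carrier (fundamental_group B (p e)) \<subseteq> (\<lambda>l. loop_class B (p e) (p \<circ> l)) ` loops_at E e"
  shows "inj_on p (topspace E)"
proof (rule inj_onI)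
  note D = proper_local_homeomorphismD[OF p]
  have lift_ends: "path_homotopic E k l"
    if "pathin E k" "pathin E l" "k 0 = l 0" "path_homotopic B (p \<circ> k) (p \<circ> l)" for k l
    using homotopy_lifting[OF p that(4)] that by auto
  have pathB: "pathin B (p \<circ> k)" if "pathin E k" for k
    using that D(2) continuous_map_compose by (auto simp: pathin_def)
  have fibre: "k 1 = e" if k: "pathin E k" "k 0 = e" "p (k 1) = p e" for k
  proof -
    have q: "p \<circ> k \<in> loops_at B (p e)"
      using k pathB by (auto simp: loops_at_def)
    then have "loop_class B (p e) (p \<circ> k) \<in> (\<lambda>l. loop_class B (p e) (p \<circ> l)) ` loops_at E e"
      using full unfolding carrier_fundamental_group by blast
    then obtain l where l: "l \<in> loops_at E e" "loop_class B (p e) (p \<circ> k) = loop_class B (p e) (p \<circ> l)"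
      by auto
    have "p \<circ> l \<in> loops_at B (p e)"
      using l(1) pathB by (auto simp: loops_at_def)
    then have "path_homotopic B (p \<circ> k) (p \<circ> l)"
      using l(2) loop_class_eq_iff[OF q] by simp
    then have "path_homotopic E k l"
      using k l by (intro lift_ends) (auto simp: loops_at_def)
    then show ?thesis
      using path_homotopic_ends(2)[of E k l] l(1) by (simp add: loops_at_def)
  qed
  fix a b assume ab: "a \<in> topspace E" "b \<in> topspace E" "p a = p b"
  obtain g where g: "pathin E g" "g 0 = e" "g 1 = a"
    using E e ab(1) unfolding path_connected_space_def by blast
  have "pathin B (p \<circ> path_rev g)"
    by (intro pathB pathin_rev g)
  then obtain k where k: "pathin E k" "k 0 = b" "\<And>t. t \<in> {0..1} \<Longrightarrow> p (k t) = (p \<circ> path_rev g) t"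
    using path_lifting[OF p, of "p \<circ> path_rev g" b] ab g by auto
  have "k 1 = e"
  proof -
    obtain d where d: "pathin E d" "d 0 = e" "d 1 = b"
      using E e ab(2) unfolding path_connected_space_def by blast
    have "pathin E (loop_join d k)" "p (k 1) = p e"
      using d k k(3)[of 1] g by (auto intro!: pathin_join)
    then show ?thesis
      using fibre[of "loop_join d k"] d by simp
  qed
  have "path_homotopic B (p \<circ> path_rev k) (p \<circ> g)"
    using k(1) k(3) by (intro path_homotopic_eq pathB pathin_rev) (auto simp: path_rev_def)
  then have "path_homotopic E (path_rev k) g"
    using k g \<open>k 1 = e\<close> by (intro lift_ends pathin_rev) auto
  then show "a = b"
    using path_homotopic_ends(2)[of E "path_rev k" g] k(2) g(3) by simp
qed

section \<open>Boxes in Euclidean space and in the half-space\<close>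

definition coords :: "nat \<Rightarrow> (nat \<Rightarrow> real) set"
  where "coords n = {x. \<forall>i\<ge>n. x i = 0}"

definition half_coords :: "nat \<Rightarrow> (nat \<Rightarrow> real) set"
  where "half_coords n = {x \<in> coords n. 0 \<le> x 0}"

definition pos_coords :: "nat \<Rightarrow> (nat \<Rightarrow> real) set"
  where "pos_coords n = {x \<in> coords n. 0 < x 0}"

definition box_around :: "nat \<Rightarrow> (nat \<Rightarrow> real) \<Rightarrow> real \<Rightarrow> (nat \<Rightarrow> real) set"
  where "box_around n c \<epsilon> = {x. \<forall>i<n. \<bar>x i - c i\<bar> < \<epsilon>}"

definition coordinatewise_convex :: "(nat \<Rightarrow> real) set \<Rightarrow> bool"
  where "coordinatewise_convex S \<longleftrightarrow>
    (\<forall>x\<in>S. \<forall>y\<in>S. \<forall>t\<in>{0..1}. (\<lambda>i. (1 - t) * x i + t * y i) \<in> S)"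

definition simply_connected_space :: "'a topology \<Rightarrow> bool"
  where "simply_connected_space Z \<longleftrightarrow>
    path_connected_space Z \<and> (\<forall>a. \<forall>p\<in>loops_at Z a. path_homotopic Z p (\<lambda>t. a))"

lemma Euclidean_space_eq: "Euclidean_space n = top_of_set (coords n)"
  by (simp add: Euclidean_space_def coords_def euclidean_product_topology)

lemma Euclidean_half_space_eq: "Euclidean_half_space n = top_of_set (half_coords n)"
  by (simp add: Euclidean_half_space_def Euclidean_space_eq half_coords_def subtopology_subtopology Int_def)

lemma open_box_around: "open (box_around n c \<epsilon>)"
proof -
  have "open {x::nat \<Rightarrow> real. \<bar>x i - c i\<bar> < \<epsilon>}" for i
    by (intro open_Collect_less continuous_intros continuous_on_product_coordinates)
  then have "open (\<Inter>i\<in>{..<n}. {x::nat \<Rightarrow> real. \<bar>x i - c i\<bar> < \<epsilon>})"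
    by blast
  moreover have "(\<Inter>i\<in>{..<n}. {x::nat \<Rightarrow> real. \<bar>x i - c i\<bar> < \<epsilon>}) = box_around n c \<epsilon>"
    by (auto simp: box_around_def)
  ultimately show ?thesis
    by simp
qed

lemma open_contains_box:
  assumes W: "open W" and c: "c \<in> W" "c \<in> coords n"
  obtains \<epsilon> where "\<epsilon> > 0" "coords n \<inter> box_around n c \<epsilon> \<subseteq> W"
proof -
  have "openin (product_topology (\<lambda>i. euclidean) UNIV) W"
    using W by (simp add: euclidean_product_topology)
  then obtain X where X: "c \<in> (\<Pi>\<^sub>E i\<in>UNIV. X i)" "\<And>i. open (X i)" "(\<Pi>\<^sub>E i\<in>UNIV. X i) \<subseteq> W"
    using product_topology_open_contains_basis[OF _ c(1), of "\<lambda>i. euclidean" UNIV] by auto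
  have "\<exists>e>0. ball (c i) e \<subseteq> X i" for i
    using X(1,2) by (meson PiE_mem UNIV_I openE)
  then obtain e where e: "\<And>i. e i > 0" "\<And>i. ball (c i) (e i) \<subseteq> X i"
    by metis
  define \<epsilon> where "\<epsilon> = Min (insert 1 (e ` {..<n}))"
  have \<epsilon>: "\<epsilon> > 0" "\<And>i. i < n \<Longrightarrow> \<epsilon> \<le> e i"
    using e(1) by (auto simp: \<epsilon>_def)
  show ?thesis
  proof
    show "coords n \<inter> box_around n c \<epsilon> \<subseteq> W"
    proof
      fix x assume x: "x \<in> coords n \<inter> box_around n c \<epsilon>"
      have "x i \<in> X i" for i
      proof (cases "i < n")
        case True
        then have "\<bar>x i - c i\<bar> < e i"
          using x \<epsilon>(2) by (force simp: box_around_def)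
        then show ?thesis
          using e(2)[of i] by (auto simp: dist_real_def abs_minus_commute)
      next
        case False
        then have "x i = c i"
          using x c(2) by (simp add: coords_def)
        then show ?thesis
          using X(1) by auto
      qed
      then show "x \<in> W"
        using X(3) by auto
    qed
  qed (rule \<epsilon>)
qed

lemma coordinatewise_convex_Int:
  "coordinatewise_convex S \<Longrightarrow> coordinatewise_convex T \<Longrightarrow> coordinatewise_convex (S \<inter> T)"
  by (simp add: coordinatewise_convex_def)

lemma coordinatewise_convex_coords: "coordinatewise_convex (coords n)"
  by (simp add: coordinatewise_convex_def coords_def)

lemma coordinatewise_convex_half_coords: "coordinatewise_convex (half_coords n)"
  by (auto simp: coordinatewise_convex_def coords_def half_coords_def)

lemma coordinatewise_convex_pos_coords: "coordinatewise_convex (pos_coords n)"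
  unfolding coordinatewise_convex_def
proof (intro ballI)
  fix x y :: "nat \<Rightarrow> real" and t :: real
  assume x: "x \<in> pos_coords n" and y: "y \<in> pos_coords n" and t: "t \<in> {0..1}"
  have "0 < (1 - t) * x 0 + t * y 0"
  proof (cases "t = 1")
    case False
    then have "0 < (1 - t) * x 0" "0 \<le> t * y 0"
      using x y t by (auto simp: pos_coords_def)
    then show ?thesis
      by simp
  qed (use y in \<open>simp add: pos_coords_def\<close>)
  then show "(\<lambda>i. (1 - t) * x i + t * y i) \<in> pos_coords n"
    using x y by (simp add: pos_coords_def coords_def)
qed

lemma coordinatewise_convex_box: "coordinatewise_convex (box_around n c \<epsilon>)"
  unfolding coordinatewise_convex_def
proof (intro ballI)
  fix x y :: "nat \<Rightarrow> real" and t :: real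
  assume x: "x \<in> box_around n c \<epsilon>" and y: "y \<in> box_around n c \<epsilon>" and t: "t \<in> {0..1}"
  have "(1 - t) * x i + t * y i \<in> {c i - \<epsilon><..<c i + \<epsilon>}" if "i < n" for i
    using convexD[OF convex_real_interval(8), of "x i" "c i - \<epsilon>" "c i + \<epsilon>" "y i" "1 - t" t] x y t that
    by (force simp: box_around_def abs_less_iff)
  then show "(\<lambda>i. (1 - t) * x i + t * y i) \<in> box_around n c \<epsilon>"
    by (auto simp: box_around_def abs_less_iff field_simps)
qed

text \<open>
  Straight lines connect points and contract loops.
\<close>

lemma simply_connected_coordinatewise_convex:
  assumes S: "coordinatewise_convex S"
  shows "simply_connected_space (top_of_set S)"
  unfolding simply_connected_space_def path_connected_space_def
proof (intro conjI ballI allI)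
  fix x y assume "x \<in> topspace (top_of_set S)" "y \<in> topspace (top_of_set S)"
  then have xy: "x \<in> S" "y \<in> S"
    by simp_all
  have "continuous_on {0..1} (\<lambda>t i. (1 - t) * x i + t * y i)"
    by (intro continuous_on_coordinatewise_then_product continuous_intros)
  then have "pathin (top_of_set S) (\<lambda>t i. (1 - t) * x i + t * y i)"
    using S xy by (simp add: pathin_def coordinatewise_convex_def image_subset_iff Pi_iff)
  then show "\<exists>g. pathin (top_of_set S) g \<and> g 0 = x \<and> g 1 = y"
    by (intro exI[of _ "\<lambda>t i. (1 - t) * x i + t * y i"]) simp
next
  fix a p assume "p \<in> loops_at (top_of_set S) a"
  then have p: "continuous_on {0..1} p" "\<And>t. t \<in> {0..1} \<Longrightarrow> p t \<in> S" "p 0 = a" "p 1 = a"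
    by (auto simp: loops_at_def pathin_def)
  let ?Q = "{0..1} \<times> {0..1} :: (real \<times> real) set"
  let ?h = "\<lambda>z i. (1 - fst z) * p (snd z) i + fst z * a i"
  have pi: "continuous_on ?Q (\<lambda>z. p (snd z) i)" for i
  proof (rule continuous_on_product_then_coordinatewise)
    show "continuous_on ?Q (\<lambda>z. p (snd z))"
      by (intro continuous_on_compose2[OF p(1)] continuous_intros) auto
  qed
  have "continuous_on ?Q ?h"
    by (intro continuous_on_coordinatewise_then_product continuous_intros pi)
  moreover have "a \<in> S"
    using p(2)[of 0] p(3) by simp
  then have "?h z \<in> S" if "z \<in> ?Q" for z
    using that S p(2)[of "snd z"] unfolding coordinatewise_convex_def by auto
  ultimately have "continuous_map (top_of_set ?Q) (top_of_set S) ?h"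
    by auto
  then show "path_homotopic (top_of_set S) p (\<lambda>t. a)"
  proof (rule path_homotopicI)
    show "?h (t, 0) = p 0" "?h (t, 1) = p 1" if "t \<in> {0..1}" for t
      using p(3,4) by (simp_all add: fun_eq_iff flip: distrib_right)
  qed simp_all
qed

lemma homeomorphic_simply_connected_space:
  assumes fg: "homeomorphic_maps X Y f g" and Y: "simply_connected_space Y"
  shows "simply_connected_space X"
  unfolding simply_connected_space_def
proof (intro conjI allI ballI)
  show "path_connected_space X"
    using fg Y homeomorphic_path_connected_space
    unfolding simply_connected_space_def homeomorphic_space_def by blast
  have f: "continuous_map X Y f" and g: "continuous_map Y X g" and gf: "\<And>x. x \<in> topspace X \<Longrightarrow> g (f x) = x"
    using fg by (auto simp: homeomorphic_maps_def)
  fix a p assume p: "p \<in> loops_at X a"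
  then have pX: "pathin X p" "p 0 = a" "p 1 = a"
    by (auto simp: loops_at_def)
  have pt: "p t \<in> topspace X" if "t \<in> {0..1}" for t
    using pX(1) that by (auto simp: pathin_def continuous_map_def)
  have "f \<circ> p \<in> loops_at Y (f a)"
    using pX continuous_map_compose[OF _ f] by (auto simp: loops_at_def pathin_def)
  then have "path_homotopic Y (f \<circ> p) (\<lambda>t. f a)"
    using Y by (simp add: simply_connected_space_def)
  then have *: "path_homotopic X (g \<circ> (f \<circ> p)) (g \<circ> (\<lambda>t. f a))"
    by (rule path_homotopic_compose[OF _ g])
  have "path_homotopic X p (g \<circ> (f \<circ> p))"
    by (intro path_homotopic_eq pX) (simp add: gf pt)
  also note *
  also have "g \<circ> (\<lambda>t. f a) = (\<lambda>t::real. a)"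
    using gf[of a] pt[of 0] pX(2) by (simp add: fun_eq_iff)
  finally show "path_homotopic X p (\<lambda>t. a)" .
qed

section \<open>Charts\<close>

text \<open>
  A set that is open in the whole space and contained in the half-space stays away from the bounding
  hyperplane. Invariance of domain is used through this fact.
\<close>

lemma open_subset_of_half_space:
  assumes T: "openin (Euclidean_space n) T" and half: "T \<subseteq> half_coords n" and c: "c \<in> T" and n: "0 < n"
  shows "0 < c 0"
proof -
  obtain W where W: "open W" "T = coords n \<inter> W"
    using T by (auto simp: Euclidean_space_eq openin_open)
  have c': "c \<in> coords n" "c \<in> W"
    using c W by auto
  then obtain \<epsilon> where \<epsilon>: "\<epsilon> > 0" "coords n \<inter> box_around n c \<epsilon> \<subseteq> W"
    using open_contains_box[OF W(1)] by blast
  let ?d = "c(0 := c 0 - \<epsilon>/2)"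
  have "?d \<in> coords n \<inter> box_around n c \<epsilon>"
    using c' \<epsilon>(1) n by (auto simp: coords_def box_around_def)
  then have "?d \<in> half_coords n"
    using \<epsilon> W half by auto
  then show ?thesis
    using \<epsilon>(1) by (simp add: half_coords_def)
qed

text \<open>
  The logarithm of the first coordinate.
\<close>

lemma pos_coords_homeomorphic:
  assumes n: "0 < n"
  shows "top_of_set (pos_coords n) homeomorphic_space Euclidean_space n"
proof -
  have "homeomorphic_maps (top_of_set (pos_coords n)) (top_of_set (coords n))
      (\<lambda>x. x(0 := ln (x 0))) (\<lambda>x. x(0 := exp (x 0)))"
    unfolding homeomorphic_maps_def
  proof (intro conjI ballI)
    have pos: "x 0 \<noteq> 0" if "x \<in> pos_coords n" for x
      using that by (simp add: pos_coords_def)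
    have coordinate: "continuous_on A (\<lambda>x::nat \<Rightarrow> real. x i)" for A i
      by (rule continuous_on_subset[OF continuous_on_product_coordinates]) simp
    have "continuous_on (pos_coords n) (\<lambda>x. x(0 := ln (x 0)))"
    proof (rule continuous_on_coordinatewise_then_product)
      show "continuous_on (pos_coords n) (\<lambda>x. (x(0 := ln (x 0))) i)" for i
        using pos by (cases "i = 0") (auto intro!: continuous_intros coordinate)
    qed
    then show "continuous_map (top_of_set (pos_coords n)) (top_of_set (coords n)) (\<lambda>x. x(0 := ln (x 0)))"
      using n by (auto simp: pos_coords_def coords_def)
    have "continuous_on (coords n) (\<lambda>x. x(0 := exp (x 0)))"
    proof (rule continuous_on_coordinatewise_then_product)
      show "continuous_on (coords n) (\<lambda>x. (x(0 := exp (x 0))) i)" for i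
        by (cases "i = 0") (auto intro!: continuous_intros coordinate)
    qed
    then show "continuous_map (top_of_set (coords n)) (top_of_set (pos_coords n)) (\<lambda>x. x(0 := exp (x 0)))"
      using n by (auto simp: pos_coords_def coords_def)
  qed (auto simp: pos_coords_def)
  then show ?thesis
    unfolding Euclidean_space_eq homeomorphic_space_def by blast
qed

text \<open>
  The two kinds of charts are treated together: \<open>Q\<close> is the image of the chart and \<open>R\<close> is the part of \<open>Q\<close>
  that corresponds to interior points. The half-space of dimension \<open>0\<close> is all of Euclidean space and
  has no bounding hyperplane, so it is counted among the charts of the first kind.
\<close>

definition chart_domain :: "nat \<Rightarrow> (nat \<Rightarrow> real) set \<Rightarrow> (nat \<Rightarrow> real) set \<Rightarrow> bool"
  where "chart_domain n Q R \<longleftrightarrow>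
    Q = coords n \<and> R = coords n \<or> 0 < n \<and> Q = half_coords n \<and> R = pos_coords n"

lemma chart_domainD:
  assumes "chart_domain n Q R"
  shows "R \<subseteq> Q" "Q \<subseteq> coords n" "coordinatewise_convex Q" "coordinatewise_convex R"
    "top_of_set R homeomorphic_space Euclidean_space n" "openin (top_of_set Q) R"
    "\<And>T x. openin (Euclidean_space n) T \<Longrightarrow> T \<subseteq> Q \<Longrightarrow> x \<in> T \<Longrightarrow> x \<in> R"
    "\<And>x \<epsilon>. x \<in> Q \<Longrightarrow> \<epsilon> > 0 \<Longrightarrow> \<exists>y\<in>R. y \<in> box_around n x \<epsilon>"
proof -
  have half: "half_coords n \<subseteq> coords n" "pos_coords n \<subseteq> half_coords n"
    by (auto simp: pos_coords_def half_coords_def)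
  show "R \<subseteq> Q" "Q \<subseteq> coords n" 
    using assms half by (auto simp: chart_domain_def)
  show "coordinatewise_convex Q" "coordinatewise_convex R"
    using assms coordinatewise_convex_coords coordinatewise_convex_half_coords coordinatewise_convex_pos_coords
    by (auto simp: chart_domain_def)
  show "top_of_set R homeomorphic_space Euclidean_space n"
    using assms pos_coords_homeomorphic homeomorphic_space_refl[of "Euclidean_space n"]
    unfolding chart_domain_def Euclidean_space_eq by metis
  show "openin (top_of_set Q) R"
  proof -
    have "open {x::nat \<Rightarrow> real. 0 < x 0}"
      by (intro open_Collect_less continuous_intros continuous_on_product_coordinates)
    then have "openin (top_of_set (half_coords n)) (half_coords n \<inter> {x. 0 < x 0})"
      by blast
    also have "half_coords n \<inter> {x. 0 < x 0} = pos_coords n"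
      by (auto simp: half_coords_def pos_coords_def)
    finally show ?thesis
      using assms by (auto simp: chart_domain_def)
  qed
  show "x \<in> R" if T: "openin (Euclidean_space n) T" "T \<subseteq> Q" "x \<in> T" for T x
  proof (cases "Q = coords n \<and> R = coords n")
    case False
    then have "0 < n" "Q = half_coords n" "R = pos_coords n"
      using assms by (auto simp: chart_domain_def)
    then show ?thesis
      using open_subset_of_half_space[OF T(1) _ T(3)] T by (auto simp: half_coords_def pos_coords_def)
  qed (use T in auto)
  show "\<exists>y\<in>R. y \<in> box_around n x \<epsilon>" if x: "x \<in> Q" and \<epsilon>: "\<epsilon> > 0" for x \<epsilon>
  proof (cases "Q = coords n \<and> R = coords n")
    case True
    then show ?thesis
      using x \<epsilon> by (intro bexI[of _ x]) (auto simp: box_around_def)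
  next
    case False
    then have *: "0 < n" "Q = half_coords n" "R = pos_coords n"
      using assms by (auto simp: chart_domain_def)
    show ?thesis
    proof
      show "x(0 := x 0 + \<epsilon>/2) \<in> R"
        using x \<epsilon> * by (auto simp: half_coords_def pos_coords_def coords_def)
      show "x(0 := x 0 + \<epsilon>/2) \<in> box_around n x \<epsilon>"
        using \<epsilon> by (auto simp: box_around_def)
    qed
  qed
qed

lemma manifold_interior_subset: "manifold_interior n X \<subseteq> topspace X"
  using openin_subset by (fastforce simp: manifold_interior_def)

lemma openin_manifold_interior: "openin X (manifold_interior n X)"
proof (subst openin_subopen, intro ballI)
  fix x assume "x \<in> manifold_interior n X"
  then obtain U where "openin X U" "x \<in> U" "subtopology X U homeomorphic_space Euclidean_space n"
    by (auto simp: manifold_interior_def)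
  then show "\<exists>T. openin X T \<and> x \<in> T \<and> T \<subseteq> manifold_interior n X"
    by (intro exI[of _ U]) (auto simp: manifold_interior_def)
qed

text \<open>
  Invariance of domain, transported to the source manifold by a chart.
\<close>

lemma invariance_of_domain_manifold:
  assumes S: "openin X S" and x: "x \<in> S" "x \<in> manifold_interior n X"
    and g: "continuous_map (subtopology X S) (Euclidean_space n) g" and inj: "inj_on g S"
  obtains T where "openin (Euclidean_space n) T" "g x \<in> T" "T \<subseteq> g ` S"
proof -
  let ?E = "Euclidean_space n"
  obtain U \<phi> \<psi> where U: "openin X U" "x \<in> U" and h: "homeomorphic_maps (subtopology X U) ?E \<phi> \<psi>"
    using x(2) by (auto simp: manifold_interior_def homeomorphic_space_def)
  have \<psi>\<phi>: "\<psi> (\<phi> u) = u" if "u \<in> U" for u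
    using h that openin_subset[OF U(1)] by (auto simp: homeomorphic_maps_def)
  have SU: "openin (subtopology X U) (S \<inter> U)"
    using S by (auto simp: openin_subtopology)
  have "open_map (subtopology X U) ?E \<phi>"
    using h homeomorphic_imp_open_map homeomorphic_maps_map by blast
  then have D: "openin ?E (\<phi> ` (S \<inter> U))"
    using SU by (simp add: open_map_def)
  have "continuous_map (subtopology ?E (\<phi> ` (S \<inter> U))) (subtopology X S) \<psi>"
  proof -
    have "continuous_map ?E X \<psi>"
      using h by (auto simp: homeomorphic_maps_def continuous_map_in_subtopology)
    then show ?thesis
      using \<psi>\<phi> openin_subset[OF S]
      by (auto simp: continuous_map_in_subtopology continuous_map_from_subtopology)
  qed
  then have "continuous_map (subtopology ?E (\<phi> ` (S \<inter> U))) ?E (g \<circ> \<psi>)"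
    using g by (rule continuous_map_compose)
  moreover have "inj_on (g \<circ> \<psi>) (\<phi> ` (S \<inter> U))"
    using inj \<psi>\<phi> by (auto simp: inj_on_def)
  ultimately have "openin ?E ((g \<circ> \<psi>) ` \<phi> ` (S \<inter> U))"
    using invariance_of_domain_Euclidean_space[OF D] by blast
  moreover have "(g \<circ> \<psi>) ` \<phi> ` (S \<inter> U) = g ` (S \<inter> U)"
    using \<psi>\<phi> by (force simp: image_image)
  ultimately have "openin ?E (g ` (S \<inter> U))"
    by simp
  then show ?thesis
    using that[of "g ` (S \<inter> U)"] x U by blast
qed

text \<open>
  That a point on the bounding hyperplane is not an interior point of the manifold is a case of
  invariance of domain: otherwise the chart would map a neighbourhood of it onto a neighbourhood in the
  whole Euclidean space.
\<close>

lemma manifold_chart: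
  assumes X: "topological_manifold n X" and x: "x \<in> topspace X"
  obtains U \<phi> \<psi> Q R where "openin X U" "x \<in> U" "homeomorphic_maps (subtopology X U) (top_of_set Q) \<phi> \<psi>"
    "chart_domain n Q R" "\<And>u. u \<in> U \<Longrightarrow> u \<in> manifold_interior n X \<longleftrightarrow> \<phi> u \<in> R"
proof -
  obtain U where U: "openin X U" "x \<in> U"
    "subtopology X U homeomorphic_space Euclidean_space n \<or> subtopology X U homeomorphic_space Euclidean_half_space n"
    using X x unfolding topological_manifold_def by blast
  have "\<exists>Q R. subtopology X U homeomorphic_space top_of_set Q \<and> chart_domain n Q R"
  proof (cases "subtopology X U homeomorphic_space Euclidean_space n")
    case True
    then show ?thesis
      by (auto simp: Euclidean_space_eq chart_domain_def)
  next
    case False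
    then have half: "subtopology X U homeomorphic_space top_of_set (half_coords n)"
      using U by (simp add: Euclidean_half_space_eq)
    show ?thesis
    proof (cases "n = 0")
      case True
      then have "half_coords n = coords n"
        by (auto simp: half_coords_def coords_def)
      then show ?thesis
        using half by (auto simp: chart_domain_def)
    next
      case False
      then show ?thesis
        using half by (auto simp: chart_domain_def)
    qed
  qed
  then obtain Q R \<phi> \<psi> where h: "homeomorphic_maps (subtopology X U) (top_of_set Q) \<phi> \<psi>" and QR: "chart_domain n Q R"
    by (auto simp: homeomorphic_space_def)
  note D = chart_domainD[OF QR]
  have UX: "U \<subseteq> topspace X"
    using U(1) by (rule openin_subset)
  have \<phi>: "continuous_map (subtopology X U) (top_of_set Q) \<phi>" and \<psi>\<phi>: "\<And>u. u \<in> U \<Longrightarrow> \<psi> (\<phi> u) = u"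
    and \<phi>\<psi>: "\<And>q. q \<in> Q \<Longrightarrow> \<phi> (\<psi> q) = q" and \<psi>Q: "\<And>q. q \<in> Q \<Longrightarrow> \<psi> q \<in> U"
    using h UX by (auto simp: homeomorphic_maps_def continuous_map_in_subtopology Pi_iff)
  have inj: "inj_on \<phi> U"
    using \<psi>\<phi> by (metis inj_onI)
  have "u \<in> manifold_interior n X \<longleftrightarrow> \<phi> u \<in> R" if u: "u \<in> U" for u
  proof
    assume "u \<in> manifold_interior n X"
    moreover have "continuous_map (subtopology X U) (Euclidean_space n) \<phi>"
      using \<phi> D(2) by (auto simp: Euclidean_space_eq continuous_map_in_subtopology)
    ultimately obtain T where "openin (Euclidean_space n) T" "\<phi> u \<in> T" "T \<subseteq> \<phi> ` U"
      using invariance_of_domain_manifold[OF U(1) u] inj by blast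
    moreover have "\<phi> ` U \<subseteq> Q"
      using \<phi> UX by (auto simp: continuous_map_in_subtopology)
    ultimately show "\<phi> u \<in> R"
      using D(7) by blast
  next
    assume R: "\<phi> u \<in> R"
    let ?V = "{v \<in> U. \<phi> v \<in> R}"
    have "openin (subtopology X U) {v \<in> topspace (subtopology X U). \<phi> v \<in> R}"
      using \<phi> D(6) by (rule openin_continuous_map_preimage)
    moreover have "{v \<in> topspace (subtopology X U). \<phi> v \<in> R} = ?V"
      using UX by auto
    ultimately have "openin (subtopology X U) ?V"
      by simp
    then have openV: "openin X ?V"
      using U(1) openin_trans_full by blast
    have "homeomorphic_maps (subtopology (subtopology X U) ?V) (subtopology (top_of_set Q) R) \<phi> \<psi>"
      by (rule homeomorphic_maps_subtopologies_alt[OF h]) (use D(1) \<phi>\<psi> \<psi>Q UX in auto)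
    moreover have "U \<inter> ?V = ?V" "Q \<inter> R = R"
      using D(1) by auto
    ultimately have "subtopology X ?V homeomorphic_space top_of_set R"
      by (auto simp: homeomorphic_space_def subtopology_subtopology)
    then have "subtopology X ?V homeomorphic_space Euclidean_space n"
      using D(5) homeomorphic_space_trans by blast
    then show "u \<in> manifold_interior n X"
      using openV u R unfolding manifold_interior_def by blast
  qed
  then show ?thesis
    using that U h QR by blast
qed

text \<open>
  The neighbourhood is the part of a chart lying over a small box; its interior points correspond to
  another convex set, and each of its points is a limit of interior points.
\<close>

lemma manifold_neighbourhood:
  assumes X: "topological_manifold n X" and M: "openin X M" "x \<in> M"
  obtains V where "openin X V" "x \<in> V" "V \<subseteq> M" "path_connected_space (subtopology X V)"
    "simply_connected_space (subtopology X (V \<inter> manifold_interior n X))"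
    "V \<subseteq> X closure_of (V \<inter> manifold_interior n X)"
proof -
  have "x \<in> topspace X"
    using M openin_subset by blast
  then obtain U \<phi> \<psi> Q R where U: "openin X U" "x \<in> U"
    and h: "homeomorphic_maps (subtopology X U) (top_of_set Q) \<phi> \<psi>" and QR: "chart_domain n Q R"
    and int: "\<And>u. u \<in> U \<Longrightarrow> u \<in> manifold_interior n X \<longleftrightarrow> \<phi> u \<in> R"
    using manifold_chart[OF X] by metis
  note D = chart_domainD[OF QR]
  have UX: "U \<subseteq> topspace X"
    using U(1) by (rule openin_subset)
  have \<phi>: "continuous_map (subtopology X U) (top_of_set Q) \<phi>" and \<psi>\<phi>: "\<And>u. u \<in> U \<Longrightarrow> \<psi> (\<phi> u) = u"
    and \<phi>\<psi>: "\<And>q. q \<in> Q \<Longrightarrow> \<phi> (\<psi> q) = q" and \<psi>Q: "\<And>q. q \<in> Q \<Longrightarrow> \<psi> q \<in> U" and \<phi>U: "\<And>u. u \<in> U \<Longrightarrow> \<phi> u \<in> Q"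
    using h UX by (auto simp: homeomorphic_maps_def continuous_map_in_subtopology Pi_iff)
  have boxes: "\<exists>\<epsilon>>0. \<forall>q\<in>Q. q \<in> box_around n (\<phi> z) \<epsilon> \<longrightarrow> \<psi> q \<in> N"
    if N: "openin X N" "z \<in> N" "z \<in> U" for N z
  proof -
    have "openin (top_of_set Q) {q \<in> topspace (top_of_set Q). \<psi> q \<in> U \<inter> N}"
    proof (rule openin_continuous_map_preimage)
      show "continuous_map (top_of_set Q) (subtopology X U) \<psi>"
        using h by (simp add: homeomorphic_maps_def)
      show "openin (subtopology X U) (U \<inter> N)"
        using N(1) by (simp add: openin_subtopology_Int2)
    qed
    then obtain W where W: "open W" "{q \<in> Q. \<psi> q \<in> U \<inter> N} = Q \<inter> W"
      by (auto simp: openin_open)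
    have "\<phi> z \<in> Q \<inter> W"
      using N \<phi>U \<psi>\<phi> W(2)[symmetric] by simp
    then obtain \<epsilon> where "\<epsilon> > 0" "coords n \<inter> box_around n (\<phi> z) \<epsilon> \<subseteq> W"
      using open_contains_box[OF W(1)] D(2) by blast
    then show ?thesis
      using W(2) D(2) by (intro exI[of _ \<epsilon>]) blast
  qed
  obtain \<epsilon> where \<epsilon>: "\<epsilon> > 0" "\<And>q. q \<in> Q \<Longrightarrow> q \<in> box_around n (\<phi> x) \<epsilon> \<Longrightarrow> \<psi> q \<in> M"
    using boxes[OF M U(2)] by blast
  let ?B = "box_around n (\<phi> x) \<epsilon>"
  define V where "V = {u \<in> topspace (subtopology X U). \<phi> u \<in> Q \<inter> ?B}"
  have V: "V = {u \<in> U. \<phi> u \<in> ?B}"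
    using UX \<phi>U by (auto simp: V_def)
  have "openin (top_of_set Q) (Q \<inter> ?B)"
    using open_box_around by blast
  then have "openin (subtopology X U) V"
    unfolding V_def using \<phi> by (intro openin_continuous_map_preimage)
  then have openV: "openin X V"
    using U(1) openin_trans_full by blast
  have xV: "x \<in> V"
    using U \<epsilon>(1) by (auto simp: V box_around_def)
  have VM: "V \<subseteq> M"
    using \<epsilon>(2) \<phi>U \<psi>\<phi> by (fastforce simp: V)
  have sub: "simply_connected_space (subtopology X {u \<in> U. \<phi> u \<in> C})"
    if C: "coordinatewise_convex C" "C \<subseteq> Q" for C
  proof -
    have "homeomorphic_maps (subtopology (subtopology X U) {u \<in> U. \<phi> u \<in> C}) (subtopology (top_of_set Q) C) \<phi> \<psi>"
      by (rule homeomorphic_maps_subtopologies_alt[OF h]) (use C(2) \<phi>\<psi> \<psi>Q in auto)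
    moreover have "U \<inter> {u \<in> U. \<phi> u \<in> C} = {u \<in> U. \<phi> u \<in> C}" "Q \<inter> C = C"
      using C by auto
    ultimately have "homeomorphic_maps (subtopology X {u \<in> U. \<phi> u \<in> C}) (top_of_set C) \<phi> \<psi>"
      by (simp add: subtopology_subtopology)
    then show ?thesis
      using homeomorphic_simply_connected_space simply_connected_coordinatewise_convex[OF C(1)] by blast
  qed
  have "V = {u \<in> U. \<phi> u \<in> Q \<inter> ?B}"
    using V \<phi>U by auto
  then have pc: "path_connected_space (subtopology X V)"
    using sub[of "Q \<inter> ?B"] D(3) coordinatewise_convex_Int coordinatewise_convex_box
    by (simp add: simply_connected_space_def)
  have "V \<inter> manifold_interior n X = {u \<in> U. \<phi> u \<in> R \<inter> ?B}"
    using V int by auto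
  then have sc: "simply_connected_space (subtopology X (V \<inter> manifold_interior n X))"
    using sub[of "R \<inter> ?B"] D(1,4) coordinatewise_convex_Int coordinatewise_convex_box by auto
  have "V \<subseteq> X closure_of (V \<inter> manifold_interior n X)"
  proof
    fix z assume z: "z \<in> V"
    show "z \<in> X closure_of (V \<inter> manifold_interior n X)"
      unfolding in_closure_of
    proof (intro conjI allI impI)
      show "z \<in> topspace X"
        using z UX V by auto
      fix N assume N: "z \<in> N \<and> openin X N"
      have zU: "z \<in> U"
        using z V by blast
      have NV: "openin X (N \<inter> V)" "z \<in> N \<inter> V"
        using N openV z by auto
      obtain \<delta> where \<delta>: "\<delta> > 0" "\<And>q. q \<in> Q \<Longrightarrow> q \<in> box_around n (\<phi> z) \<delta> \<Longrightarrow> \<psi> q \<in> N \<inter> V"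
        using boxes[OF NV zU] by blast
      obtain q where q: "q \<in> R" "q \<in> box_around n (\<phi> z) \<delta>"
        using D(8)[OF \<phi>U[OF zU] \<delta>(1)] by blast
      then have "\<psi> q \<in> N \<inter> V" "\<psi> q \<in> manifold_interior n X"
        using \<delta>(2)[of q] D(1) int[of "\<psi> q"] \<psi>Q \<phi>\<psi> by auto
      then show "\<exists>y. y \<in> V \<inter> manifold_interior n X \<and> y \<in> N"
        by blast
    qed
  qed
  then show ?thesis
    by (rule that[OF openV xV VM pc sc])
qed

text \<open>
  Composing with a chart of \<open>Y\<close> reduces the claim to maps into Euclidean space. The image is open there,
  so it avoids the bounding hyperplane.
\<close>

lemma manifold_invariance_of_domain:
  assumes Y: "topological_manifold n Y" and S: "openin X S" and x: "x \<in> S" "x \<in> manifold_interior n X"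
    and g: "continuous_map (subtopology X S) Y g" and inj: "inj_on g S"
  shows "g x \<in> manifold_interior n Y" and "\<exists>T. openin Y T \<and> g x \<in> T \<and> T \<subseteq> g ` S"
proof -
  have SX: "S \<subseteq> topspace X"
    using S by (rule openin_subset)
  then have "g x \<in> topspace Y"
    using g x(1) by (auto simp: continuous_map_def)
  then obtain W \<phi> \<psi> Q R where W: "openin Y W" "g x \<in> W"
    and h: "homeomorphic_maps (subtopology Y W) (top_of_set Q) \<phi> \<psi>" and QR: "chart_domain n Q R"
    and int: "\<And>w. w \<in> W \<Longrightarrow> w \<in> manifold_interior n Y \<longleftrightarrow> \<phi> w \<in> R"
    using manifold_chart[OF Y] by metis
  note D = chart_domainD[OF QR]
  have WY: "W \<subseteq> topspace Y"
    using W(1) by (rule openin_subset)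
  have \<phi>: "continuous_map (subtopology Y W) (top_of_set Q) \<phi>" and \<psi>\<phi>: "\<And>u. u \<in> W \<Longrightarrow> \<psi> (\<phi> u) = u"
    and \<phi>W: "\<And>u. u \<in> W \<Longrightarrow> \<phi> u \<in> Q"
    using h WY by (auto simp: homeomorphic_maps_def continuous_map_in_subtopology Pi_iff)
  define S' where "S' = {s \<in> topspace (subtopology X S). g s \<in> W}"
  have S': "S' = {s \<in> S. g s \<in> W}"
    using SX by (auto simp: S'_def)
  have "openin (subtopology X S) S'"
    unfolding S'_def using g W(1) by (rule openin_continuous_map_preimage)
  then have openS': "openin X S'"
    using S openin_trans_full by blast
  have "continuous_map (subtopology X S') (subtopology Y W) g"
    using g S' continuous_map_from_subtopology_mono[OF g, of S'] by (auto simp: continuous_map_in_subtopology)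
  moreover have "continuous_map (subtopology Y W) (Euclidean_space n) \<phi>"
    using \<phi> D(2) by (auto simp: Euclidean_space_eq continuous_map_in_subtopology)
  ultimately have "continuous_map (subtopology X S') (Euclidean_space n) (\<phi> \<circ> g)"
    by (rule continuous_map_compose)
  moreover have "inj_on (\<phi> \<circ> g) S'"
    using inj S' \<psi>\<phi> unfolding inj_on_def comp_def by (metis (no_types, lifting) mem_Collect_eq)
  moreover have "x \<in> S'"
    using S' x W by blast
  ultimately obtain T where T: "openin (Euclidean_space n) T" "\<phi> (g x) \<in> T" "T \<subseteq> (\<phi> \<circ> g) ` S'"
    using invariance_of_domain_manifold[OF openS' _ x(2), of "\<phi> \<circ> g"] by auto
  have TQ: "T \<subseteq> Q"
    using T(3) \<phi>W S' by auto
  have "\<phi> (g x) \<in> R"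
    using D(7)[OF T(1) TQ T(2)] .
  then show "g x \<in> manifold_interior n Y"
    using int W(2) by blast
  have "openin (top_of_set Q) T"
    using T(1) TQ D(2) unfolding Euclidean_space_eq by (rule openin_subset_trans)
  then have "openin (subtopology Y W) {w \<in> topspace (subtopology Y W). \<phi> w \<in> T}"
    using \<phi> by (intro openin_continuous_map_preimage)
  then have "openin Y {w \<in> topspace (subtopology Y W). \<phi> w \<in> T}"
    using W(1) openin_trans_full by blast
  moreover have "{w \<in> topspace (subtopology Y W). \<phi> w \<in> T} \<subseteq> g ` S"
  proof
    fix w assume w: "w \<in> {w \<in> topspace (subtopology Y W). \<phi> w \<in> T}"
    then obtain s where s: "s \<in> S'" "\<phi> w = \<phi> (g s)"
      using T(3) by auto
    then have "w = g s"
      using \<psi>\<phi>[of w] \<psi>\<phi>[of "g s"] w S' by auto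
    then show "w \<in> g ` S"
      using s S' by blast
  qed
  moreover have "g x \<in> {w \<in> topspace (subtopology Y W). \<phi> w \<in> T}"
    using T(2) W(2) WY by auto
  ultimately show "\<exists>T. openin Y T \<and> g x \<in> T \<and> T \<subseteq> g ` S"
    by (intro exI conjI)
qed

section \<open>Immersions of a compact manifold with boundary\<close>

text \<open>
  The projected path is a loop, hence homotopic to a constant path; so its lift is homotopic
  to a constant path and therefore closed.
\<close>

lemma simply_connected_base_injective:
  assumes p: "proper_local_homeomorphism E B p" and B: "simply_connected_space B"
    and g: "pathin E g" and eq: "p (g 0) = p (g 1)"
  shows "g 0 = g 1"
proof -
  note D = proper_local_homeomorphismD[OF p]
  have "p \<circ> g \<in> loops_at B (p (g 1))"
    using g eq continuous_map_compose[OF _ D(2)] by (auto simp: loops_at_def pathin_def)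
  then have null: "path_homotopic B (p \<circ> g) (\<lambda>t. p (g 1))"
    using B by (simp add: simply_connected_space_def)
  have "g 0 \<in> topspace E"
    using g by (auto simp: pathin_def continuous_map_def)
  then have "path_homotopic E g (\<lambda>t. g 0)"
    using g eq by (intro homotopy_lifting[OF p null]) (auto simp: pathin_def)
  then show ?thesis
    using path_homotopic_ends(2)[of E g "\<lambda>t. g 0"] by simp
qed

text \<open>
  Manifolds are locally path-connected.
\<close>

lemma path_connected_manifold:
  assumes "topological_manifold n X" "connected_space X"
  shows "path_connected_space X"
proof -
  have "locally_path_connected_space X"
    unfolding locally_path_connected_space_def neighbourhood_base_of
  proof (intro allI impI)
    fix W x assume "openin X W \<and> x \<in> W"
    then obtain V where V: "openin X V" "x \<in> V" "V \<subseteq> W" "path_connected_space (subtopology X V)"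
      using manifold_neighbourhood[OF assms(1)] by metis
    then have "path_connectedin X V"
      by (simp add: path_connectedin_def openin_subset)
    then show "\<exists>U V. openin X U \<and> path_connectedin X V \<and> x \<in> U \<and> U \<subseteq> V \<and> V \<subseteq> W"
      using V by blast
  qed
  then show ?thesis
    using path_connected_eq_connected_space assms(2) by blast
qed

locale manifold_immersion =
  fixes n :: nat and X :: "'a topology" and Y :: "'b topology" and f :: "'a \<Rightarrow> 'b"
  assumes X: "topological_manifold n X" and compact: "compact_space X" and Y: "topological_manifold n Y"
    and cont: "continuous_map X Y f"
    and boundary_to_boundary: "f ` manifold_boundary n X \<subseteq> manifold_boundary n Y"
    and boundary_immersion: "immersion_map (subtopology X (manifold_boundary n X)) Y f"
    and interior_immersion: "immersion_map (subtopology X (topspace X - manifold_boundary n X)) Y f"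
begin

lemma Hausdorff: "Hausdorff_space X" "Hausdorff_space Y"
  using X Y by (simp_all add: topological_manifold_def)

lemma proper: "proper_map X Y f"
  using compact cont Hausdorff(2) by (simp add: continuous_imp_proper_map Hausdorff_imp_kc_space)

lemma closed: "closed_map X Y f"
  using proper by (simp add: proper_map_def)

lemma interior_locally_injective:
  assumes "x \<in> manifold_interior n X"
  obtains U where "openin X U" "x \<in> U" "U \<subseteq> manifold_interior n X" "inj_on f U"
proof -
  let ?I = "subtopology X (manifold_interior n X)"
  have "topspace X - manifold_boundary n X = manifold_interior n X"
    using manifold_interior_subset[of n X] by (auto simp: manifold_boundary_def)
  then have "immersion_map ?I Y f"
    using interior_immersion by simp
  moreover have x: "x \<in> topspace ?I"
    using assms manifold_interior_subset[of n X] by auto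
  ultimately obtain U where U: "openin ?I U" "x \<in> U"
      "homeomorphic_map (subtopology ?I U) (subtopology Y (f ` U)) f"
    unfolding immersion_map_def by blast
  have UI: "openin X U" "U \<subseteq> manifold_interior n X"
    using U(1) openin_open_subtopology[OF openin_manifold_interior, of X n U] by simp_all
  moreover have "inj_on f U"
    using homeomorphic_imp_injective_map[OF U(3)] openin_subset[OF U(1)] by (simp add: inf_absorb2)
  ultimately show ?thesis
    using that U(2) by blast
qed

lemma boundary_locally_injective:
  assumes "x \<in> manifold_boundary n X"
  obtains U where "openin X U" "x \<in> U" "inj_on f (U \<inter> manifold_boundary n X)"
proof -
  let ?D = "subtopology X (manifold_boundary n X)"
  have "x \<in> topspace ?D"
    using assms by (auto simp: manifold_boundary_def)
  then obtain U where U: "openin ?D U" "x \<in> U"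
      "homeomorphic_map (subtopology ?D U) (subtopology Y (f ` U)) f"
    using boundary_immersion unfolding immersion_map_def by blast
  have "inj_on f U"
    using homeomorphic_imp_injective_map[OF U(3)] openin_subset[OF U(1)] by (simp add: inf_absorb2)
  moreover obtain W where "openin X W" "U = W \<inter> manifold_boundary n X"
    using U(1) by (auto simp: openin_subtopology)
  ultimately show ?thesis
    using that U(2) by blast
qed

lemma interior_open:
  assumes M: "openin X M" "x \<in> M" and x: "x \<in> manifold_interior n X"
  shows "f x \<in> manifold_interior n Y" and "\<exists>T. openin Y T \<and> f x \<in> T \<and> T \<subseteq> f ` M"
proof -
  obtain U where U: "openin X U" "x \<in> U" "U \<subseteq> manifold_interior n X" "inj_on f U"
    using interior_locally_injective[OF x] by blast
  have MU: "openin X (M \<inter> U)" "x \<in> M \<inter> U"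
    using M U by auto
  have "continuous_map (subtopology X (M \<inter> U)) Y f" "inj_on f (M \<inter> U)"
    using cont U(4) by (auto simp: continuous_map_from_subtopology intro: inj_on_subset)
  note * = manifold_invariance_of_domain[OF Y MU x this]
  show "f x \<in> manifold_interior n Y"
    by (rule *(1))
  show "\<exists>T. openin Y T \<and> f x \<in> T \<and> T \<subseteq> f ` M"
    using *(2) by blast
qed

text \<open>
  So the whole fibre of a boundary point of \<open>Y\<close> lies in the boundary of \<open>X\<close>.
\<close>

lemma interior_iff:
  assumes "x \<in> topspace X"
  shows "f x \<in> manifold_interior n Y \<longleftrightarrow> x \<in> manifold_interior n X"
proof
  assume "f x \<in> manifold_interior n Y"
  then show "x \<in> manifold_interior n X"
    using assms boundary_to_boundary by (auto simp: manifold_boundary_def)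
next
  assume "x \<in> manifold_interior n X"
  then show "f x \<in> manifold_interior n Y"
    by (rule interior_open(1)[OF openin_topspace assms])
qed

lemma open_map_interior:
  assumes "openin X S" "S \<subseteq> manifold_interior n X"
  shows "openin Y (f ` S)"
proof (subst openin_subopen, intro ballI)
  fix y assume "y \<in> f ` S"
  then show "\<exists>T. openin Y T \<and> y \<in> T \<and> T \<subseteq> f ` S"
    using interior_open(2)[OF assms(1)] assms(2) by blast
qed

text \<open>
  Properness passes to full preimages, so over the interior of \<open>Y\<close> the map is already known to be a
  finite covering.
\<close>

lemma proper_local_homeomorphism_interior:
  assumes V: "V \<subseteq> manifold_interior n Y" "openin Y V"
  shows "proper_local_homeomorphism (subtopology X {x \<in> topspace X. f x \<in> V}) (subtopology Y V) f"
    (is "proper_local_homeomorphism ?E ?B f")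
  unfolding proper_local_homeomorphism_def
proof (intro conjI ballI)
  let ?P = "{x \<in> topspace X. f x \<in> V}"
  have P: "openin X ?P" "?P \<subseteq> manifold_interior n X"
    using V cont interior_iff by (auto intro: openin_continuous_map_preimage)
  show "Hausdorff_space ?E"
    by (rule Hausdorff_space_subtopology[OF Hausdorff(1)])
  show "continuous_map ?E ?B f"
    using cont by (auto simp: continuous_map_in_subtopology continuous_map_from_subtopology)
  show "proper_map ?E ?B f"
    by (rule proper_map_restriction[OF proper]) simp
  show "open_map ?E ?B f"
    unfolding open_map_def
  proof (intro allI impI)
    fix S assume "openin ?E S"
    then have S: "openin X S" "S \<subseteq> ?P"
      using openin_open_subtopology[OF P(1), of S] by simp_all
    then have "openin Y (f ` S)"
      using P(2) by (intro open_map_interior) auto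
    then show "openin ?B (f ` S)"
      using S(2) V(2) by (auto simp: openin_open_subtopology)
  qed
  fix e assume "e \<in> topspace ?E"
  then have e: "e \<in> ?P"
    by simp
  then obtain U where U: "openin X U" "e \<in> U" "inj_on f U"
    using P(2) interior_locally_injective by (metis subsetD)
  have "openin ?E (U \<inter> ?P)"
    using U(1) P(1) by (auto simp: openin_open_subtopology)
  then show "\<exists>U. openin ?E U \<and> e \<in> U \<and> inj_on f U"
    using e U by (intro exI[of _ "U \<inter> ?P"]) (auto intro: inj_on_subset)
qed

text \<open>
  Local surjectivity at a boundary point. Since \<open>f\<close> is injective near \<open>x\<close> on the boundary, \<open>x\<close> can be
  separated by open sets from the rest \<open>C\<close> of its fibre. As \<open>f\<close> is closed, every point over a small
  neighbourhood \<open>V\<close> of \<open>f x\<close> lies near \<open>x\<close> or near \<open>C\<close>; let \<open>U\<close> be the set of those near \<open>x\<close>. Then the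
  interior part of \<open>U\<close> has an image that is open and closed in the connected interior part of \<open>V\<close>, and
  \<open>f ` U\<close> is closed in \<open>V\<close>, so it contains the limits of interior points as well.
\<close>

lemma boundary_neighbourhood:
  assumes x: "x \<in> manifold_boundary n X" and M: "openin X M" "x \<in> M"
  obtains U V where "openin X U" "x \<in> U" "U \<subseteq> M" "openin Y V" "f ` U = V"
    "simply_connected_space (subtopology Y (V \<inter> manifold_interior n Y))"
    "inj_on f (U \<inter> manifold_boundary n X)"
proof -
  let ?iX = "manifold_interior n X" and ?iY = "manifold_interior n Y"
  let ?y = "f x"
  have xX: "x \<in> topspace X"
    using x by (simp add: manifold_boundary_def)
  then have yY: "?y \<in> topspace Y"
    using cont by (auto simp: continuous_map_def)
  have y: "?y \<notin> ?iY"
    using x boundary_to_boundary by (auto simp: manifold_boundary_def)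
  obtain N where N: "openin X N" "x \<in> N" "inj_on f (N \<inter> manifold_boundary n X)"
    using boundary_locally_injective[OF x] by blast
  define C where "C = {z \<in> topspace X. f z \<in> {?y}} - N"
  have fibre: "z \<in> C \<or> z = x" if z: "z \<in> topspace X" "f z = ?y" for z
  proof (cases "z \<in> N")
    case True
    have "z \<in> manifold_boundary n X"
      using z y interior_iff[OF z(1)] by (simp add: manifold_boundary_def)
    then show ?thesis
      using N(2,3) True x z(2) by (auto dest: inj_onD)
  qed (use z in \<open>auto simp: C_def\<close>)
  have "closedin Y {?y}"
    using Hausdorff(2) yY by (simp add: closedin_Hausdorff_singleton)
  then have "closedin X {z \<in> topspace X. f z \<in> {?y}}"
    using cont by (intro closedin_continuous_map_preimage)
  then have C: "closedin X C"
    unfolding C_def using N(1) by blast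
  have "x \<in> topspace X - C"
    using xX N(2) by (simp add: C_def)
  then obtain N1 N2 where N12: "openin X N1" "openin X N2" "x \<in> N1" "C \<subseteq> N2" "disjnt N1 N2"
    using compact_Hausdorff_imp_regular_space[OF compact Hausdorff(1)] C
    unfolding regular_space_def by metis
  define O1 where "O1 = N1 \<inter> N \<inter> M"
  have O1: "openin X O1" "x \<in> O1" "O1 \<inter> N2 = {}"
    using N12 N M by (auto simp: O1_def disjnt_def)
  \<comment> \<open>Points outside the neighbourhoods of the fibre have a closed image that misses \<open>f x\<close>.\<close>
  have "closedin X (topspace X - (O1 \<union> N2))"
    using O1 N12 by (intro closedin_diff) auto
  then have "closedin Y (f ` (topspace X - (O1 \<union> N2)))"
    using closed by (simp add: closed_map_def)
  then have "openin Y (topspace Y - f ` (topspace X - (O1 \<union> N2)))" (is "openin Y ?W")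
    by blast
  moreover have "z \<in> O1 \<union> N2" if "z \<in> topspace X" "?y = f z" for z
    using fibre[OF that(1) that(2)[symmetric]] O1(2) N12(4) by blast
  then have "?y \<in> ?W"
    using yY by blast
  ultimately obtain V where V: "openin Y V" "?y \<in> V" "V \<subseteq> ?W"
    "simply_connected_space (subtopology Y (V \<inter> ?iY))" "V \<subseteq> Y closure_of (V \<inter> ?iY)"
    using manifold_neighbourhood[OF Y] by metis
  define U where "U = {z \<in> topspace X. f z \<in> V} \<inter> O1"
  have U: "openin X U" "x \<in> U"
    using O1 V(1,2) cont xX by (auto simp: U_def intro!: openin_continuous_map_preimage)
  have split: "z \<in> U" if "z \<in> topspace X - N2" "f z \<in> V" for z
    using that V(3) by (auto simp: U_def)
  have UN2: "U \<subseteq> topspace X - N2"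
    using O1(3) by (auto simp: U_def)
  \<comment> \<open>Removing \<open>N2\<close> from \<open>X\<close> leaves a closed set with the same points over \<open>V\<close> as \<open>U\<close>.\<close>
  let ?B = "subtopology Y (V \<inter> ?iY)"
  have topB: "topspace ?B = V \<inter> ?iY"
    using openin_subset[OF V(1)] by auto
  have eq: "f ` (U \<inter> ?iX) = V \<inter> ?iY \<inter> f ` (topspace X - N2)"
  proof (intro equalityI subsetI)
    fix w assume "w \<in> f ` (U \<inter> ?iX)"
    then show "w \<in> V \<inter> ?iY \<inter> f ` (topspace X - N2)"
      using UN2 interior_iff by (auto simp: U_def)
  next
    fix w assume "w \<in> V \<inter> ?iY \<inter> f ` (topspace X - N2)"
    then obtain z where z: "z \<in> topspace X - N2" "w = f z" "f z \<in> V" "f z \<in> ?iY"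
      by auto
    then have "z \<in> U \<inter> ?iX"
      using split interior_iff by auto
    then show "w \<in> f ` (U \<inter> ?iX)"
      using z by blast
  qed
  have closedN2: "closedin Y (f ` (topspace X - N2))"
    using closed N12(2) by (simp add: closed_map_def closedin_diff)
  have "f ` (U \<inter> ?iX) = {} \<or> f ` (U \<inter> ?iX) = topspace ?B"
  proof -
    have "openin Y (f ` (U \<inter> ?iX))"
      using U(1) openin_manifold_interior by (intro open_map_interior) auto
    then have "openin ?B (f ` (U \<inter> ?iX))"
      using eq by (metis Int_assoc Int_lower1 inf.absorb_iff2 openin_subtopology_Int2)
    moreover have "closedin ?B (f ` (U \<inter> ?iX))"
      unfolding eq using closedN2 by (rule closedin_subtopology_Int_closed)
    moreover have "connected_space ?B"
      using V(4) by (simp add: simply_connected_space_def path_connected_imp_connected_space)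
    ultimately show ?thesis
      unfolding connected_space_clopen_in by blast
  qed
  moreover have "U \<inter> ?iX \<noteq> {}"
  proof -
    obtain U' where "x \<in> U'" "U' \<subseteq> U" "U' \<subseteq> X closure_of (U' \<inter> ?iX)"
      using manifold_neighbourhood[OF X U] by metis
    then have "X closure_of (U' \<inter> ?iX) \<noteq> {}"
      by blast
    then have "U' \<inter> ?iX \<noteq> {}"
      using closure_of_empty by metis
    then show ?thesis
      using \<open>U' \<subseteq> U\<close> by blast
  qed
  ultimately have "V \<inter> ?iY \<subseteq> f ` (topspace X - N2)"
    using eq topB by blast
  then have VN2: "V \<subseteq> f ` (topspace X - N2)"
    using closure_of_minimal[OF _ closedN2] V(5) by blast
  have "f ` U = V"
  proof
    show "V \<subseteq> f ` U"
      using VN2 split by blast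
  qed (auto simp: U_def)
  moreover have "inj_on f (U \<inter> manifold_boundary n X)"
    by (rule inj_on_subset[OF N(3)]) (auto simp: U_def O1_def)
  moreover have "U \<subseteq> M"
    by (auto simp: U_def O1_def)
  ultimately show ?thesis
    using that U V(1,4) by blast
qed

text \<open>
  At a boundary point, a small half-ball \<open>U'\<close> is treated in two parts. Two of its interior points are
  joined by a path in the interior of \<open>U'\<close>, which lies over a simply connected set over which \<open>f\<close> is a
  finite covering; two of its boundary points are separated because \<open>f\<close> is an immersion on the
  boundary.
\<close>

lemma locally_injective:
  assumes x: "x \<in> topspace X"
  shows "\<exists>U. openin X U \<and> x \<in> U \<and> inj_on f U"
proof (cases "x \<in> manifold_interior n X")
  case True
  then show ?thesis
    using interior_locally_injective by metis
next
  case False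
  let ?iX = "manifold_interior n X" and ?iY = "manifold_interior n Y"
  have "x \<in> manifold_boundary n X"
    using x False by (simp add: manifold_boundary_def)
  then obtain U V where U: "openin X U" "x \<in> U" and V: "openin Y V" "f ` U = V"
    "simply_connected_space (subtopology Y (V \<inter> ?iY))" and inj: "inj_on f (U \<inter> manifold_boundary n X)"
    using boundary_neighbourhood[OF _ openin_topspace x] by metis
  obtain U' where U': "openin X U'" "x \<in> U'" "U' \<subseteq> U"
    "simply_connected_space (subtopology X (U' \<inter> ?iX))"
    using manifold_neighbourhood[OF X U] by metis
  let ?P = "{z \<in> topspace X. f z \<in> V \<inter> ?iY}"
  have plh: "proper_local_homeomorphism (subtopology X ?P) (subtopology Y (V \<inter> ?iY)) f"
    using V(1) openin_manifold_interior by (intro proper_local_homeomorphism_interior) auto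
  have UX: "U \<subseteq> topspace X"
    using U(1) by (rule openin_subset)
  have U'P: "U' \<inter> ?iX \<subseteq> ?P"
    using U'(3) UX V(2) interior_iff by auto
  have "inj_on f U'"
  proof (rule inj_onI)
    fix a b assume ab: "a \<in> U'" "b \<in> U'" "f a = f b"
    have abX: "a \<in> topspace X" "b \<in> topspace X"
      using ab U'(3) UX by auto
    show "a = b"
    proof (cases "f a \<in> ?iY")
      case True
      then have "a \<in> topspace (subtopology X (U' \<inter> ?iX))" "b \<in> topspace (subtopology X (U' \<inter> ?iX))"
        using ab abX interior_iff[OF abX(1)] interior_iff[OF abX(2)] by auto
      then obtain g where g: "pathin (subtopology X (U' \<inter> ?iX)) g" "g 0 = a" "g 1 = b"
        using U'(4) unfolding simply_connected_space_def path_connected_space_def by blast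
      have "pathin (subtopology X ?P) g"
        using g(1) U'P by (auto simp: pathin_subtopology)
      then show ?thesis
        using simply_connected_base_injective[OF plh V(3)] g ab(3) by auto
    next
      case False
      then have "a \<in> U \<inter> manifold_boundary n X" "b \<in> U \<inter> manifold_boundary n X"
        using ab abX interior_iff[OF abX(1)] interior_iff[OF abX(2)] U'(3)
        by (auto simp: manifold_boundary_def)
      then show ?thesis
        using inj ab(3) by (auto dest: inj_onD)
    qed
  qed
  then show ?thesis
    using U' by blast
qed

lemma open_map: "open_map X Y f"
  unfolding open_map_def
proof (intro allI impI)
  fix M assume M: "openin X M"
  show "openin Y (f ` M)"
  proof (subst openin_subopen, intro ballI)
    fix y assume "y \<in> f ` M"
    then obtain x where x: "x \<in> M" "y = f x"
      by blast
    show "\<exists>T. openin Y T \<and> y \<in> T \<and> T \<subseteq> f ` M"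
    proof (cases "x \<in> manifold_interior n X")
      case True
      then show ?thesis
        using interior_open(2)[OF M x(1)] x(2) by simp
    next
      case False
      then have "x \<in> manifold_boundary n X"
        using x(1) openin_subset[OF M] by (auto simp: manifold_boundary_def)
      then obtain U V where "x \<in> U" "U \<subseteq> M" "openin Y V" "f ` U = V"
        using boundary_neighbourhood[OF _ M x(1)] by metis
      then show ?thesis
        using x(2) by blast
    qed
  qed
qed

lemma proper_local_homeomorphism: "proper_local_homeomorphism X Y f"
  using Hausdorff(1) cont open_map proper locally_injective
  by (simp add: proper_local_homeomorphism_def)

end

section \<open>Immersions that are homeomorphisms\<close>

theorem theorem1p4:
  fixes X :: "'a topology" and Y :: "'b topology" and f :: "'a \<Rightarrow> 'b"
    and n :: nat and x0 :: 'a and y0 :: 'b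
  assumes "topological_manifold n X" and "connected_space X" and "compact_space X"
    and "topological_manifold n Y" and "connected_space Y"
    and "x0 \<in> topspace X" and "y0 \<in> topspace Y"
    and "continuous_map X Y f"
    and "f ` manifold_boundary n X \<subseteq> manifold_boundary n Y"
    and "immersion_map (subtopology X (manifold_boundary n X)) Y f"
    and "immersion_map (subtopology X (topspace X - manifold_boundary n X)) Y f"
    and "\<not> (\<exists>H. subgroup H (fundamental_group Y y0) \<and>
                 H \<noteq> carrier (fundamental_group Y y0) \<and>
                 finite (rcosets\<^bsub>fundamental_group Y y0\<^esub> H) \<and>
                 (fundamental_group Y y0)\<lparr>carrier := H\<rparr> \<cong> fundamental_group X x0)"
  shows "homeomorphic_map X Y f"
proof -
  interpret manifold_immersion n X Y f
    using assms(1,3,4,8-11) by unfold_locales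
  note plh = proper_local_homeomorphism
  have surj: "f ` topspace X = topspace Y"
  proof -
    have "openin Y (f ` topspace X)" "closedin Y (f ` topspace X)"
      using open_map closed by (auto simp: open_map_def closed_map_def)
    then show ?thesis
      using assms(5,6) unfolding connected_space_clopen_in by blast
  qed
  obtain e where e: "e \<in> topspace X" "f e = y0"
    using surj assms(7) by (metis imageE)
  have pc: "path_connected_space X"
    using path_connected_manifold assms(1,2) by blast
  define H where "H = (\<lambda>l. loop_class Y (f e) (f \<circ> l)) ` loops_at X e"
  note cov = covering_fundamental_group[OF plh e(1) H_def, unfolded e(2)]
  obtain \<gamma> where \<gamma>: "pathin X \<gamma>" "\<gamma> 0 = x0" "\<gamma> 1 = e"
    using pc assms(6) e(1) unfolding path_connected_space_def by blast
  have "fundamental_group X x0 \<cong> (fundamental_group Y y0)\<lparr>carrier := H\<rparr>"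
    using fundamental_group_basepoint_iso[OF \<gamma>] cov(2) by (rule iso_trans)
  then have "(fundamental_group Y y0)\<lparr>carrier := H\<rparr> \<cong> fundamental_group X x0"
    by (rule group.iso_sym[OF group_fundamental_group[OF assms(6)]])
  then have "H = carrier (fundamental_group Y y0)"
    using assms(12) cov(1,3) by blast
  then have "inj_on f (topspace X)"
    by (intro covering_injective[OF plh pc e(1)]) (simp add: H_def e(2))
  then show ?thesis
    using bijective_closed_imp_homeomorphic_map cont closed surj by blast
qed

end
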